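(* Let $n\ge 1$ and let $\Omega\subset\mathbb{R}^n$ be a non-empty open set for which there are $j\in\{1,\dots,n\}$ and $c>0$ with $\|\partial^{e_j}f\|_2\ge c\,\|f\|_2$ for all $f\in W^1_{0,\mathbb{C}}(\Omega)$. Let $\bar p_1,\bar p_2,\dots$ be a uniformly bounded sequence in $\mathcal{L}$ for which there is $\varepsilon>0$ such that $\bar p_\nu\ge\varepsilon$ (a.e. on $\Omega$) for all $\nu\in\{1,2,\dots\}$, and which converges a.e. pointwise on $\Omega$ to some $\bar p_\infty\in\mathcal{L}$. Let $\hat A_1,\hat A_2,\dots$ be the self-adjoint operators $\hat A_\nu:=\hat A_{\bar p_\nu}$ and let $\hat A_\infty:=\hat A_{\bar p_\infty}$. Then $\hat A_\nu^{-1}\to\hat A_\infty^{-1}$ strongly as $\nu\to\infty$, i.e. $\lim_{\nu\to\infty}\|\hat A_\nu^{-1}\xi-\hat A_\infty^{-1}\xi\|=0$ for every $\xi\in L^2_{\mathbb{C}}(\Omega)\times(L^2_{\mathbb{C}}(\Omega))^n$.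
   Context: $L^2_{\mathbb{C}}(\Omega)$ is the Hilbert space of complex-valued square-integrable functions (Lebesgue measure) with $\langle f|g\rangle_2=\int_\Omega f^*g$ and norm $\|\cdot\|_2$; $(L^2_{\mathbb{C}}(\Omega))^k$ carries $\langle f|g\rangle_{2,k}=\sum_{j=1}^k\langle f_j|g_j\rangle_2$ and norm $\|\cdot\|_{2,k}$; $L^2_{\mathbb{C}}(\Omega)\times(L^2_{\mathbb{C}}(\Omega))^n$ carries the product Hilbert space norm $\|\cdot\|$. $\partial^{e_k}$ is the $k$-th weak partial derivative in $L^2_{\mathbb{C}}(\Omega)$, i.e. $-1$ times the adjoint of $C_0^\infty(\Omega,\mathbb{C})\to L^2_{\mathbb{C}}(\Omega)$, $f\mapsto\partial f/\partial x_k$. $W^1_{\mathbb{C}}(\Omega)$ is the Sobolev space $\bigcap_{k=1}^n D(\partial^{e_k})$ with norm given by $\|f\|_2^2+\sum_k\|\partial^{e_k}f\|_2^2$ (squared), and $W^1_{0,\mathbb{C}}(\Omega)$ is the closure of $C_0^\infty(\Omega,\mathbb{C})$ in it. $\nabla_0:C_0^\infty(\Omega,\mathbb{C})\to(L^2_{\mathbb{C}}(\Omega))^n$ is the classical gradient, viewed as a densely-defined operator in $L^2_{\mathbb{C}}(\Omega)$; $\nabla_0^*$ is its Hilbert space adjoint, with domain $D(\nabla_0^* )\subset(L^2_{\mathbb{C}}(\Omega))^n$ and values in $L^2_{\mathbb{C}}(\Omega)$; $\nabla_w f=(\partial^{e_1}f,\dots,\partial^{e_n}f)$ for $f\in W^1_{\mathbb{C}}(\Omega)$.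 $\mathcal{L}$ is the set of real-valued $\bar p\in L^\infty(\Omega)$ for which there are real $C_2\ge C_1>0$ with $C_1\le\bar p\le C_2$ a.e. on $\Omega$. For real-valued $\bar p\in L^\infty(\Omega)$, $\hat A_{\bar p}:W^1_{0,\mathbb{C}}(\Omega)\times D(\nabla_0^* )\to L^2_{\mathbb{C}}(\Omega)\times(L^2_{\mathbb{C}}(\Omega))^n$ is the densely-defined operator $\hat A_{\bar p}(u,q)=(\nabla_0^*q,\ \nabla_w u-\bar p\,q)$. It is self-adjoint, and for $\bar p\in\mathcal{L}$ and $\Omega$ as in the claim it is bijective with bounded inverse. "Uniformly bounded" means $\sup_\nu\|\bar p_\nu\|_\infty<\infty$. *)

theory Defs
  imports "HOL-Analysis.Analysis" "HOL-Probability.Essential_Supremum"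
begin

text \<open>
  Elements of the Lebesgue spaces are represented by functions on the whole of \<open>\<real>\<^sup>n\<close>, of which only
  the values on \<open>\<Omega>\<close> matter; equality in the Hilbert spaces is equality almost everywhere on \<open>\<Omega>\<close>.
  Unbounded operators are given by a domain, which is a set of representatives closed under
  almost-everywhere equality, and a function that chooses a representative of the value.
  Tuples in \<open>(L\<^sup>2)\<^sup>n\<close> are vectors of functions; differences of functions, vectors
  and pairs are the pointwise and componentwise ones.
\<close>

type_synonym 'n cfun = "real^'n \<Rightarrow> complex"
type_synonym 'n cvec = "(real^'n \<Rightarrow> complex)^'n"


definition L2 :: "(real^'n) set \<Rightarrow> 'n cfun set" where
  "L2 \<Omega> = {f \<in> borel_measurable (lebesgue_on \<Omega>).
            integrable (lebesgue_on \<Omega>) (\<lambda>x. (cmod (f x))\<^sup>2)}"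

definition L2_inner :: "(real^'n) set \<Rightarrow> 'n cfun \<Rightarrow> 'n cfun \<Rightarrow> complex" where
  "L2_inner \<Omega> f g = (LINT x|lebesgue_on \<Omega>. cnj (f x) * g x)"

definition L2_norm :: "(real^'n) set \<Rightarrow> 'n cfun \<Rightarrow> real" where
  "L2_norm \<Omega> f = sqrt (LINT x|lebesgue_on \<Omega>. (cmod (f x))\<^sup>2)"

definition L2n :: "(real^'n) set \<Rightarrow> ('n cvec) set" where
  "L2n \<Omega> = {q. \<forall>j. q $ j \<in> L2 \<Omega>}"

definition L2n_inner :: "(real^'n) set \<Rightarrow> 'n cvec \<Rightarrow> 'n cvec \<Rightarrow> complex" where
  "L2n_inner \<Omega> q r = (\<Sum>j\<in>UNIV. L2_inner \<Omega> (q $ j) (r $ j))"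

definition L2n_norm :: "(real^'n) set \<Rightarrow> 'n cvec \<Rightarrow> real" where
  "L2n_norm \<Omega> q = sqrt (\<Sum>j\<in>UNIV. (L2_norm \<Omega> (q $ j))\<^sup>2)"

definition H_space :: "(real^'n) set \<Rightarrow> ('n cfun \<times> 'n cvec) set" where
  "H_space \<Omega> = L2 \<Omega> \<times> L2n \<Omega>"

definition H_norm :: "(real^'n) set \<Rightarrow> 'n cfun \<times> 'n cvec \<Rightarrow> real" where
  "H_norm \<Omega> \<xi> = sqrt ((L2_norm \<Omega> (fst \<xi>))\<^sup>2 + (L2n_norm \<Omega> (snd \<xi>))\<^sup>2)"

definition H_eq ::
  "(real^'n) set \<Rightarrow> 'n cfun \<times> 'n cvec \<Rightarrow> 'n cfun \<times> 'n cvec \<Rightarrow> bool" where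
  "H_eq \<Omega> \<xi> \<eta> \<longleftrightarrow>
     (AE x in lebesgue_on \<Omega>. fst \<xi> x = fst \<eta> x) \<and>
     (\<forall>j. AE x in lebesgue_on \<Omega>. (snd \<xi> $ j) x = (snd \<eta> $ j) x)"


definition classical_partial :: "'n \<Rightarrow> 'n cfun \<Rightarrow> 'n::finite cfun" where
  "classical_partial k f x = frechet_derivative f (at x) (axis k 1)"

text \<open>
  A function is \<open>C\<^sup>\<infinity>\<close> iff all of its iterated partial derivatives are differentiable
  everywhere. A test function on \<open>\<Omega>\<close> is identified with its extension by zero.
\<close>

definition smooth :: "'n::finite cfun \<Rightarrow> bool" where
  "smooth f \<longleftrightarrow> (\<forall>ks x. fold classical_partial ks f differentiable (at x))"

definition test_functions :: "(real^'n::finite) set \<Rightarrow> 'n cfun set" where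
  "test_functions \<Omega> = {f. smooth f \<and> compact (closure {x. f x \<noteq> 0}) \<and> closure {x. f x \<noteq> 0} \<subseteq> \<Omega>}"

definition nabla0 :: "'n cfun \<Rightarrow> 'n::finite cfun ^ 'n" where
  "nabla0 f = (\<chi> k. classical_partial k f)"


text \<open>
  The adjoint of an operator \<open>T\<close> with dense domain \<open>D\<close> in the Hilbert space
  \<open>(X, ipX)\<close> and values in the Hilbert space \<open>(Y, ipY)\<close>. Density of \<open>D\<close> makes the
  value of the adjoint unique up to equality in \<open>X\<close>.
\<close>

definition adj_graph ::
  "'x set \<Rightarrow> ('x \<Rightarrow> 'x \<Rightarrow> complex) \<Rightarrow> 'y set \<Rightarrow> ('y \<Rightarrow> 'y \<Rightarrow> complex) \<Rightarrow>
   'x set \<Rightarrow> ('x \<Rightarrow> 'y) \<Rightarrow> ('y \<times> 'x) set" where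
  "adj_graph X ipX Y ipY D T =
     {(y, z). y \<in> Y \<and> z \<in> X \<and> (\<forall>x\<in>D. ipY y (T x) = ipX z x)}"

definition weak_partial_adj :: "(real^'n::finite) set \<Rightarrow> 'n \<Rightarrow> ('n cfun \<times> 'n cfun) set" where
  "weak_partial_adj \<Omega> k =
     adj_graph (L2 \<Omega>) (L2_inner \<Omega>) (L2 \<Omega>) (L2_inner \<Omega>) (test_functions \<Omega>) (classical_partial k)"

definition weak_partial_dom :: "(real^'n::finite) set \<Rightarrow> 'n \<Rightarrow> 'n cfun set" where
  "weak_partial_dom \<Omega> k = Domain (weak_partial_adj \<Omega> k)"

definition weak_partial :: "(real^'n::finite) set \<Rightarrow> 'n \<Rightarrow> 'n cfun \<Rightarrow> 'n cfun" where
  "weak_partial \<Omega> k f = - (SOME g. (f, g) \<in> weak_partial_adj \<Omega> k)"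

definition nabla0_adj_graph :: "(real^'n::finite) set \<Rightarrow> ('n cvec \<times> 'n cfun) set" where
  "nabla0_adj_graph \<Omega> =
     adj_graph (L2 \<Omega>) (L2_inner \<Omega>) (L2n \<Omega>) (L2n_inner \<Omega>) (test_functions \<Omega>) nabla0"

definition nabla0_adj_dom :: "(real^'n::finite) set \<Rightarrow> ('n cvec) set" where
  "nabla0_adj_dom \<Omega> = Domain (nabla0_adj_graph \<Omega>)"

definition nabla0_adj :: "(real^'n::finite) set \<Rightarrow> 'n cvec \<Rightarrow> 'n cfun" where
  "nabla0_adj \<Omega> q = (SOME g. (q, g) \<in> nabla0_adj_graph \<Omega>)"


definition W1 :: "(real^'n::finite) set \<Rightarrow> 'n cfun set" where
  "W1 \<Omega> = (\<Inter>k. weak_partial_dom \<Omega> k)"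

definition W1_norm :: "(real^'n::finite) set \<Rightarrow> 'n cfun \<Rightarrow> real" where
  "W1_norm \<Omega> f = sqrt ((L2_norm \<Omega> f)\<^sup>2 + (\<Sum>k\<in>UNIV. (L2_norm \<Omega> (weak_partial \<Omega> k f))\<^sup>2))"

definition W10 :: "(real^'n::finite) set \<Rightarrow> 'n cfun set" where
  "W10 \<Omega> = {f \<in> W1 \<Omega>. \<forall>e>0. \<exists>\<phi>\<in>test_functions \<Omega>. W1_norm \<Omega> (f - \<phi>) < e}"

definition nabla_w :: "(real^'n::finite) set \<Rightarrow> 'n cfun \<Rightarrow> 'n cvec" where
  "nabla_w \<Omega> f = (\<chi> k. weak_partial \<Omega> k f)"


definition Linf_norm :: "(real^'n) set \<Rightarrow> (real^'n \<Rightarrow> real) \<Rightarrow> ereal" where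
  "Linf_norm \<Omega> p = esssup (lebesgue_on \<Omega>) (\<lambda>x. ereal \<bar>p x\<bar>)"

definition Linf :: "(real^'n) set \<Rightarrow> (real^'n \<Rightarrow> real) set" where
  "Linf \<Omega> = {p \<in> borel_measurable (lebesgue_on \<Omega>). Linf_norm \<Omega> p < \<infinity>}"

definition L_class :: "(real^'n) set \<Rightarrow> (real^'n \<Rightarrow> real) set" where
  "L_class \<Omega> = {p \<in> Linf \<Omega>. \<exists>C1 C2. 0 < C1 \<and> C1 \<le> C2 \<and>
                   (AE x in lebesgue_on \<Omega>. C1 \<le> p x \<and> p x \<le> C2)}"


definition A_hat_dom :: "(real^'n::finite) set \<Rightarrow> ('n cfun \<times> 'n cvec) set" where
  "A_hat_dom \<Omega> = W10 \<Omega> \<times> nabla0_adj_dom \<Omega>"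

definition A_hat ::
  "(real^'n::finite) set \<Rightarrow> (real^'n \<Rightarrow> real) \<Rightarrow>
   'n cfun \<times> 'n cvec \<Rightarrow> 'n cfun \<times> 'n cvec" where
  "A_hat \<Omega> p = (\<lambda>(u, q). (nabla0_adj \<Omega> q, nabla_w \<Omega> u - (\<chi> k. (\<lambda>x. of_real (p x) * (q $ k) x))))"

text \<open>
  The inverse modulo equality almost everywhere: a representative of the (unique, when the operator is
  bijective) element of the domain that is mapped to \<open>\<xi>\<close>.
\<close>

definition A_hat_inv ::
  "(real^'n::finite) set \<Rightarrow> (real^'n \<Rightarrow> real) \<Rightarrow>
   'n cfun \<times> 'n cvec \<Rightarrow> 'n cfun \<times> 'n cvec" where
  "A_hat_inv \<Omega> p \<xi> = (SOME x. x \<in> A_hat_dom \<Omega> \<and> H_eq \<Omega> (A_hat \<Omega> p x) \<xi>)"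

end

theory Submission
  imports Defs
begin

text \<open>
  Strong convergence of the inverses is a stability estimate followed by dominated convergence.
  Write \<open>(u, q)\<close> and \<open>(u', q')\<close> for the solutions of the equation with the same right-hand side
  and with coefficients \<open>p\<close> and \<open>p'\<close>, and put \<open>w = u - u'\<close>, \<open>r = q - q'\<close>. Then
  \<open>\<nabla>\<^sub>0\<^sup>* r = 0\<close> and \<open>\<nabla> w = p r + h\<close> with \<open>h = (p - p') q'\<close>. As \<open>w\<close> is a limit of test functions,
  \<open>\<langle>r, \<nabla> w\<rangle> = \<langle>\<nabla>\<^sub>0\<^sup>* r, w\<rangle> = 0\<close>, so \<open>\<epsilon> \<parallel>r\<parallel>\<^sup>2 \<le> \<langle>r, p r\<rangle> = - \<langle>r, h\<rangle>\<close> and hence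
  \<open>\<parallel>r\<parallel> \<le> \<parallel>h\<parallel> / \<epsilon>\<close>; the coercivity inequality for one partial derivative then bounds \<open>\<parallel>w\<parallel>\<close> by a
  multiple of \<open>\<parallel>h\<parallel>\<close> as well (\<open>A_hat_stability\<close>). With \<open>p = p\<^sub>\<nu>\<close> and \<open>p' = p\<^sub>\<infinity>\<close> the constants do not
  depend on \<open>\<nu>\<close>, and \<open>\<parallel>(p\<^sub>\<nu> - p\<^sub>\<infinity>) q'\<parallel>\<close> tends to \<open>0\<close> because the coefficients converge
  pointwise and are uniformly bounded (\<open>L2n_norm_mult_tendsto_0\<close>).

  The inverse is defined by a choice among preimages, so the estimate only says something about it once
  preimages are known to exist (\<open>A_hat_surjective\<close>). Eliminating \<open>q = (\<nabla> u - g) / p\<close> turns the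
  equation for \<open>(f, g)\<close> into \<open>\<langle>\<nabla> u / p, \<nabla> \<psi>\<rangle> = \<langle>f, \<psi>\<rangle> + \<langle>g / p, \<nabla> \<psi>\<rangle>\<close> for all test functions
  \<open>\<psi>\<close>, whose left-hand side is a bounded coercive form. It is solved by the Riesz
  argument: a minimizing sequence of test functions for the energy is a Cauchy sequence for this form
  (\<open>minimizing_sequence\<close>), and its limit in \<open>L\<^sup>2\<close> (\<open>L2_complete\<close>) is the solution
  (\<open>divergence_equation_solution\<close>).

  Weak derivatives and the adjoint of the gradient are choices of representatives, too. That
  two choices agree almost everywhere is the fundamental lemma of the calculus of variations
  (\<open>L2_orthogonal_to_test_functions\<close>), and that weak and classical derivatives of test functions agree
  is integration by parts (\<open>integration_by_parts\<close>).
\<close>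

section \<open>The space of square-integrable functions\<close>

lemma discriminant_bound:
  fixes a b c :: real
  assumes "a \<ge> 0" and nonneg: "\<And>t. a * t\<^sup>2 + 2 * b * t + c \<ge> 0"
  shows "b\<^sup>2 \<le> a * c"
proof (cases "a = 0")
  case True
  have "b = 0"
  proof (rule ccontr)
    assume "b \<noteq> 0"
    then show False
      using nonneg[of "- (c + 1) / (2 * b)"] True by (simp add: field_simps)
  qed
  with True show ?thesis by simp
next
  case False
  with \<open>a \<ge> 0\<close> have "a > 0" by simp
  have "a * (- b / a)\<^sup>2 + 2 * b * (- b / a) + c = c - b\<^sup>2 / a"
    using \<open>a > 0\<close> by (simp add: field_simps power2_eq_square)
  then have "b\<^sup>2 / a \<le> c"
    using nonneg[of "- b / a"] by simp
  then show ?thesis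
    using \<open>a > 0\<close> by (simp add: field_simps)
qed

lemma L2_measurable [measurable_dest]: "f \<in> L2 \<Omega> \<Longrightarrow> f \<in> borel_measurable (lebesgue_on \<Omega>)"
  by (simp add: L2_def)

lemma L2_sq_integrable: "f \<in> L2 \<Omega> \<Longrightarrow> integrable (lebesgue_on \<Omega>) (\<lambda>x. (cmod (f x))\<^sup>2)"
  by (simp add: L2_def)

lemma L2_dominated:
  assumes "f \<in> borel_measurable (lebesgue_on \<Omega>)" "integrable (lebesgue_on \<Omega>) g"
    and "AE x in lebesgue_on \<Omega>. (cmod (f x))\<^sup>2 \<le> g x"
  shows "f \<in> L2 \<Omega>"
  unfolding L2_def using assms
  by (auto intro!: Bochner_Integration.integrable_bound[OF assms(2)])

lemma L2_scale: "f \<in> L2 \<Omega> \<Longrightarrow> (\<lambda>x. c * f x) \<in> L2 \<Omega>"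
  by (auto simp: L2_def norm_mult power_mult_distrib)

lemma L2_uminus: "f \<in> L2 \<Omega> \<Longrightarrow> - f \<in> L2 \<Omega>"
  using L2_scale[of f \<Omega> "-1"] by (simp add: fun_Compl_def)

lemma L2_add:
  assumes "f \<in> L2 \<Omega>" "g \<in> L2 \<Omega>"
  shows "(\<lambda>x. f x + g x) \<in> L2 \<Omega>"
proof (rule L2_dominated)
  show "(\<lambda>x. f x + g x) \<in> borel_measurable (lebesgue_on \<Omega>)"
    using assms by (auto dest: L2_measurable)
  show "integrable (lebesgue_on \<Omega>) (\<lambda>x. 2 * (cmod (f x))\<^sup>2 + 2 * (cmod (g x))\<^sup>2)"
    using assms by (auto dest!: L2_sq_integrable)
  have "(cmod (a + b))\<^sup>2 \<le> 2 * (cmod a)\<^sup>2 + 2 * (cmod b)\<^sup>2" for a b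
  proof -
    have "(cmod (a + b))\<^sup>2 \<le> (cmod a + cmod b)\<^sup>2"
      by (simp add: norm_triangle_ineq power_mono)
    also have "\<dots> \<le> 2 * (cmod a)\<^sup>2 + 2 * (cmod b)\<^sup>2"
      using sum_squares_bound[of "cmod a" "cmod b"] by (simp add: power2_sum)
    finally show ?thesis .
  qed
  then show "AE x in lebesgue_on \<Omega>. (cmod (f x + g x))\<^sup>2 \<le> 2 * (cmod (f x))\<^sup>2 + 2 * (cmod (g x))\<^sup>2"
    by simp
qed

lemma L2_diff:
  assumes "f \<in> L2 \<Omega>" "g \<in> L2 \<Omega>"
  shows "f - g \<in> L2 \<Omega>"
  using L2_add[OF assms(1) L2_uminus[OF assms(2)]] by (simp add: fun_diff_def)

lemma L2_bounded_mult:
  assumes "f \<in> L2 \<Omega>" and [measurable]: "p \<in> borel_measurable (lebesgue_on \<Omega>)"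
    and bound: "AE x in lebesgue_on \<Omega>. \<bar>p x\<bar> \<le> K"
  shows "(\<lambda>x. of_real (p x) * f x) \<in> L2 \<Omega>"
proof (rule L2_dominated)
  show "(\<lambda>x. of_real (p x) * f x) \<in> borel_measurable (lebesgue_on \<Omega>)"
    using L2_measurable[OF assms(1)] by measurable
  show "integrable (lebesgue_on \<Omega>) (\<lambda>x. K\<^sup>2 * (cmod (f x))\<^sup>2)"
    using assms by (auto dest!: L2_sq_integrable)
  show "AE x in lebesgue_on \<Omega>. (cmod (of_real (p x) * f x))\<^sup>2 \<le> K\<^sup>2 * (cmod (f x))\<^sup>2"
    using bound
    by eventually_elim (auto simp: norm_mult power_mult_distrib abs_le_square_iff[symmetric]
        intro!: mult_right_mono)
qed

lemma measurable_cnj [measurable (raw)]: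
  "f \<in> borel_measurable M \<Longrightarrow> (\<lambda>x. cnj (f x)) \<in> borel_measurable M"
  by (rule borel_measurable_continuous_on[where f = cnj]) (auto intro!: continuous_intros)

lemma L2_mult_integrable:
  assumes "f \<in> L2 \<Omega>" "g \<in> L2 \<Omega>"
  shows "integrable (lebesgue_on \<Omega>) (\<lambda>x. cnj (f x) * g x)"
proof (rule Bochner_Integration.integrable_bound)
  show "integrable (lebesgue_on \<Omega>) (\<lambda>x. (cmod (f x))\<^sup>2 + (cmod (g x))\<^sup>2)"
    using assms by (auto dest!: L2_sq_integrable)
  show "(\<lambda>x. cnj (f x) * g x) \<in> borel_measurable (lebesgue_on \<Omega>)"
    using assms[THEN L2_measurable] by measurable
  have "cmod (f x) * cmod (g x) \<le> (cmod (f x))\<^sup>2 + (cmod (g x))\<^sup>2" for x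
    using sum_squares_bound[of "cmod (f x)" "cmod (g x)"]
      mult_nonneg_nonneg[OF norm_ge_zero norm_ge_zero, of "f x" "g x"]
    unfolding mult.assoc by linarith
  then show "AE x in lebesgue_on \<Omega>. norm (cnj (f x) * g x)
      \<le> norm ((cmod (f x))\<^sup>2 + (cmod (g x))\<^sup>2)"
    by (simp add: norm_mult)
qed

lemma L2_inner_add_right:
  assumes "f \<in> L2 \<Omega>" "g \<in> L2 \<Omega>" "h \<in> L2 \<Omega>"
  shows "L2_inner \<Omega> f (\<lambda>x. g x + h x) = L2_inner \<Omega> f g + L2_inner \<Omega> f h"
  using assms by (simp add: L2_inner_def L2_mult_integrable distrib_left)

lemma L2_inner_diff_right:
  assumes "f \<in> L2 \<Omega>" "g \<in> L2 \<Omega>" "h \<in> L2 \<Omega>"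
  shows "L2_inner \<Omega> f (g - h) = L2_inner \<Omega> f g - L2_inner \<Omega> f h"
  using assms by (simp add: L2_inner_def L2_mult_integrable right_diff_distrib)

lemma L2_inner_scale_right: "L2_inner \<Omega> f (\<lambda>x. c * g x) = c * L2_inner \<Omega> f g"
  by (simp add: L2_inner_def mult.left_commute)

lemma L2_inner_commute: "L2_inner \<Omega> f g = cnj (L2_inner \<Omega> g f)"
  unfolding L2_inner_def
  by (subst Bochner_Integration.integral_cnj[symmetric]) (simp add: mult.commute)

lemma L2_inner_add_left:
  assumes "f \<in> L2 \<Omega>" "g \<in> L2 \<Omega>" "h \<in> L2 \<Omega>"
  shows "L2_inner \<Omega> (\<lambda>x. g x + h x) f = L2_inner \<Omega> g f + L2_inner \<Omega> h f"
  by (subst (1 2 3) L2_inner_commute) (simp add: L2_inner_add_right assms)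

lemma L2_inner_diff_left:
  assumes "f \<in> L2 \<Omega>" "g \<in> L2 \<Omega>" "h \<in> L2 \<Omega>"
  shows "L2_inner \<Omega> (g - h) f = L2_inner \<Omega> g f - L2_inner \<Omega> h f"
  by (subst (1 2 3) L2_inner_commute) (simp add: L2_inner_diff_right assms)

lemma L2_inner_scale_left: "L2_inner \<Omega> (\<lambda>x. c * f x) g = cnj c * L2_inner \<Omega> f g"
  by (subst (1 2) L2_inner_commute) (simp add: L2_inner_scale_right)

lemma L2_inner_uminus_left: "L2_inner \<Omega> (- f) g = - L2_inner \<Omega> f g"
  by (simp add: L2_inner_def)

lemma L2_inner_real_mult:
  "L2_inner \<Omega> f (\<lambda>x. of_real (p x) * g x) = L2_inner \<Omega> (\<lambda>x. of_real (p x) * f x) g"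
  by (simp add: L2_inner_def mult_ac)

lemma L2_inner_cong_AE:
  assumes "f \<in> L2 \<Omega>" "f' \<in> L2 \<Omega>" "g \<in> L2 \<Omega>" "g' \<in> L2 \<Omega>"
    and "AE x in lebesgue_on \<Omega>. f x = f' x" "AE x in lebesgue_on \<Omega>. g x = g' x"
  shows "L2_inner \<Omega> f g = L2_inner \<Omega> f' g'"
  unfolding L2_inner_def
proof (rule integral_cong_AE)
  show "AE x in lebesgue_on \<Omega>. cnj (f x) * g x = cnj (f' x) * g' x"
    using assms(5,6) by eventually_elim simp
qed (use assms(1-4)[THEN L2_measurable] in measurable)

lemma L2_norm_nonneg: "0 \<le> L2_norm \<Omega> f"
  by (simp add: L2_norm_def)

lemma L2_norm_sq: "(L2_norm \<Omega> f)\<^sup>2 = (LINT x|lebesgue_on \<Omega>. (cmod (f x))\<^sup>2)"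
  by (simp add: L2_norm_def)

lemma L2_norm_sq_inner: "L2_inner \<Omega> f f = of_real ((L2_norm \<Omega> f)\<^sup>2)"
proof -
  have "L2_inner \<Omega> f f = (LINT x|lebesgue_on \<Omega>. complex_of_real ((cmod (f x))\<^sup>2))"
    unfolding L2_inner_def
    by (intro Bochner_Integration.integral_cong refl) (metis complex_norm_square mult.commute)
  then show ?thesis by (simp only: integral_complex_of_real L2_norm_sq)
qed

lemma L2_norm_cong_AE:
  assumes "f \<in> borel_measurable (lebesgue_on \<Omega>)" "g \<in> borel_measurable (lebesgue_on \<Omega>)"
    and "AE x in lebesgue_on \<Omega>. f x = g x"
  shows "L2_norm \<Omega> f = L2_norm \<Omega> g"
proof -
  have "(LINT x|lebesgue_on \<Omega>. (cmod (f x))\<^sup>2) = (LINT x|lebesgue_on \<Omega>. (cmod (g x))\<^sup>2)"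
  proof (rule integral_cong_AE)
    show "AE x in lebesgue_on \<Omega>. (cmod (f x))\<^sup>2 = (cmod (g x))\<^sup>2"
      using assms(3) by eventually_elim simp
  qed (use assms(1,2) in measurable)
  then show ?thesis by (simp add: L2_norm_def)
qed

lemma L2_norm_uminus: "L2_norm \<Omega> (- f) = L2_norm \<Omega> f"
  by (simp add: L2_norm_def)

lemma L2_norm_minus_commute: "L2_norm \<Omega> (f - g) = L2_norm \<Omega> (g - f)"
  by (simp add: L2_norm_def norm_minus_commute)

lemma L2_norm_scale: "L2_norm \<Omega> (\<lambda>x. c * f x) = cmod c * L2_norm \<Omega> f"
  by (simp add: L2_norm_def norm_mult power_mult_distrib real_sqrt_mult)

lemma L2_norm_mono:
  assumes "f \<in> L2 \<Omega>" "g \<in> L2 \<Omega>"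
    and "AE x in lebesgue_on \<Omega>. cmod (f x) \<le> cmod (g x)"
  shows "L2_norm \<Omega> f \<le> L2_norm \<Omega> g"
  unfolding L2_norm_def real_sqrt_le_iff
  using assms by (intro integral_mono_AE) (auto intro: L2_sq_integrable power_mono elim: eventually_mono)

lemma L2_norm_bounded_mult:
  assumes "f \<in> L2 \<Omega>" "p \<in> borel_measurable (lebesgue_on \<Omega>)"
    and "AE x in lebesgue_on \<Omega>. \<bar>p x\<bar> \<le> K" "0 \<le> K"
  shows "L2_norm \<Omega> (\<lambda>x. of_real (p x) * f x) \<le> K * L2_norm \<Omega> f"
proof -
  have "L2_norm \<Omega> (\<lambda>x. of_real (p x) * f x) \<le> L2_norm \<Omega> (\<lambda>x. of_real K * f x)"
    using assms
    by (intro L2_norm_mono L2_bounded_mult L2_scale)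
      (auto simp: norm_mult intro!: mult_right_mono elim!: eventually_mono)
  then show ?thesis
    using \<open>0 \<le> K\<close> by (simp add: L2_norm_scale)
qed

text \<open>The quadratic \<open>t \<mapsto> \<integral> (t |f| + |g|)\<^sup>2\<close> is nonnegative, so its discriminant is not positive. Working
  with \<open>|f|\<close> and \<open>|g|\<close> keeps the quadratic real.\<close>

lemma L2_Cauchy_Schwarz:
  assumes "f \<in> L2 \<Omega>" "g \<in> L2 \<Omega>"
  shows "cmod (L2_inner \<Omega> f g) \<le> L2_norm \<Omega> f * L2_norm \<Omega> g"
proof -
  let ?I = "\<lambda>h. integral\<^sup>L (lebesgue_on \<Omega>) h"
  define b where "b = ?I (\<lambda>x. cmod (f x) * cmod (g x))"
  have int: "integrable (lebesgue_on \<Omega>) (\<lambda>x. cmod (f x) * cmod (g x))"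
    using integrable_norm[OF L2_mult_integrable[OF assms]] by (simp add: norm_mult)
  have "0 \<le> (L2_norm \<Omega> f)\<^sup>2 * t\<^sup>2 + 2 * b * t + (L2_norm \<Omega> g)\<^sup>2" for t
  proof -
    have "0 \<le> ?I (\<lambda>x. (t * cmod (f x) + cmod (g x))\<^sup>2)"
      by simp
    also have "\<dots> = ?I (\<lambda>x. t\<^sup>2 * (cmod (f x))\<^sup>2 + 2 * t * (cmod (f x) * cmod (g x)) + (cmod (g x))\<^sup>2)"
      by (intro Bochner_Integration.integral_cong refl) (simp add: power2_sum power_mult_distrib mult_ac)
    also have "\<dots> = t\<^sup>2 * (L2_norm \<Omega> f)\<^sup>2 + 2 * t * b + (L2_norm \<Omega> g)\<^sup>2"
      using int assms[THEN L2_sq_integrable] by (simp add: b_def L2_norm_sq)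
    finally show ?thesis by (simp add: mult_ac)
  qed
  then have "b\<^sup>2 \<le> (L2_norm \<Omega> f)\<^sup>2 * (L2_norm \<Omega> g)\<^sup>2"
    by (intro discriminant_bound) auto
  then have "b \<le> L2_norm \<Omega> f * L2_norm \<Omega> g"
    by (intro power2_le_imp_le[of b]) (simp_all add: power_mult_distrib L2_norm_nonneg)
  moreover have "cmod (L2_inner \<Omega> f g) \<le> b"
    unfolding L2_inner_def b_def
    using integral_norm_bound[of "lebesgue_on \<Omega>" "\<lambda>x. cnj (f x) * g x"] by (simp add: norm_mult)
  ultimately show ?thesis by simp
qed

lemma L2_norm_add_sq:
  assumes "f \<in> L2 \<Omega>" "g \<in> L2 \<Omega>"
  shows "(L2_norm \<Omega> (\<lambda>x. f x + g x))\<^sup>2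
    = (L2_norm \<Omega> f)\<^sup>2 + 2 * Re (L2_inner \<Omega> f g) + (L2_norm \<Omega> g)\<^sup>2"
proof -
  have "complex_of_real ((L2_norm \<Omega> (\<lambda>x. f x + g x))\<^sup>2)
      = L2_inner \<Omega> f f + L2_inner \<Omega> f g + (L2_inner \<Omega> g f + L2_inner \<Omega> g g)"
    by (simp only: L2_norm_sq_inner[symmetric] L2_inner_add_left L2_inner_add_right L2_add assms)
  then have "(L2_norm \<Omega> (\<lambda>x. f x + g x))\<^sup>2
      = Re (L2_inner \<Omega> f f + L2_inner \<Omega> f g + (cnj (L2_inner \<Omega> f g) + L2_inner \<Omega> g g))"
    by (subst (asm) L2_inner_commute[of \<Omega> g f]) (simp only: complex_eq_iff Re_complex_of_real add.assoc)
  then show ?thesis by (simp add: L2_norm_sq_inner)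
qed

lemma L2_norm_triangle:
  assumes "f \<in> L2 \<Omega>" "g \<in> L2 \<Omega>"
  shows "L2_norm \<Omega> (\<lambda>x. f x + g x) \<le> L2_norm \<Omega> f + L2_norm \<Omega> g"
proof (rule power2_le_imp_le)
  have "Re (L2_inner \<Omega> f g) \<le> L2_norm \<Omega> f * L2_norm \<Omega> g"
    using L2_Cauchy_Schwarz[OF assms] complex_Re_le_cmod order_trans by blast
  then show "(L2_norm \<Omega> (\<lambda>x. f x + g x))\<^sup>2 \<le> (L2_norm \<Omega> f + L2_norm \<Omega> g)\<^sup>2"
    by (simp add: L2_norm_add_sq[OF assms] power2_sum)
qed (simp add: L2_norm_nonneg)

lemma L2_norm_diff_triangle:
  assumes "f \<in> L2 \<Omega>" "g \<in> L2 \<Omega>"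
  shows "L2_norm \<Omega> (f - g) \<le> L2_norm \<Omega> f + L2_norm \<Omega> g"
  using L2_norm_triangle[OF assms(1) L2_uminus[OF assms(2)]]
  by (simp add: L2_norm_uminus fun_diff_def)

lemma L2_inner_tendsto_left:
  assumes f: "\<And>m. f m \<in> L2 \<Omega>" and g: "g \<in> L2 \<Omega>" and h: "h \<in> L2 \<Omega>"
    and lim: "(\<lambda>m. L2_norm \<Omega> (f m - g)) \<longlonglongrightarrow> 0"
  shows "(\<lambda>m. L2_inner \<Omega> (f m) h) \<longlonglongrightarrow> L2_inner \<Omega> g h"
proof -
  have "(\<lambda>m. L2_norm \<Omega> (f m - g) * L2_norm \<Omega> h) \<longlonglongrightarrow> 0"
    using tendsto_mult_right[OF lim] by simp
  then have "(\<lambda>m. L2_inner \<Omega> (f m - g) h) \<longlonglongrightarrow> 0"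
    by (rule Lim_null_comparison[rotated]) (simp add: L2_Cauchy_Schwarz L2_diff f g h)
  then show ?thesis
    by (simp add: L2_inner_diff_left f g h LIM_zero_iff)
qed

lemma L2_inner_tendsto_right:
  assumes "\<And>m. f m \<in> L2 \<Omega>" "g \<in> L2 \<Omega>" "h \<in> L2 \<Omega>" "(\<lambda>m. L2_norm \<Omega> (f m - g)) \<longlonglongrightarrow> 0"
  shows "(\<lambda>m. L2_inner \<Omega> h (f m)) \<longlonglongrightarrow> L2_inner \<Omega> h g"
  using tendsto_cnj[OF L2_inner_tendsto_left[OF assms]]
  by (simp flip: L2_inner_commute)

text \<open>This is the Riesz--Fischer theorem. Along a subsequence whose consecutive differences
  \<open>d\<^sub>k\<close> have norm at most \<open>4\<^sup>-\<^sup>k\<close>, the series \<open>\<Sum> 2\<^sup>k |d\<^sub>k|\<^sup>2\<close> has a finite integral. So almost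
  everywhere \<open>|d\<^sub>k|\<close> is dominated by a geometric sequence and the subsequence converges pointwise;
  Fatou's lemma turns this into convergence in norm of the whole sequence.\<close>

lemma L2_complete:
  fixes f :: "nat \<Rightarrow> real^'n \<Rightarrow> complex"
  assumes L2: "\<And>m. f m \<in> L2 \<Omega>"
    and cauchy: "\<And>e. e > 0 \<Longrightarrow> \<exists>N. \<forall>m\<ge>N. \<forall>n\<ge>N. L2_norm \<Omega> (f m - f n) < e"
  obtains g where "g \<in> L2 \<Omega>" "(\<lambda>m. L2_norm \<Omega> (f m - g)) \<longlonglongrightarrow> 0"
proof -
  let ?M = "lebesgue_on \<Omega>"
  have [measurable]: "f m \<in> borel_measurable ?M" for m
    using L2 by (rule L2_measurable)
  have "\<forall>k. \<exists>N. \<forall>m\<ge>N. \<forall>n\<ge>N. L2_norm \<Omega> (f m - f n) < (1/4)^k"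
    by (intro allI cauchy) simp
  then obtain N where N: "\<And>k m n. N k \<le> m \<Longrightarrow> N k \<le> n \<Longrightarrow> L2_norm \<Omega> (f m - f n) < (1/4)^k"
    by metis
  \<comment> \<open>Summing the thresholds makes the chosen indices monotone.\<close>
  define r where "r k = (\<Sum>i\<le>k. N i)" for k
  have r_ge: "N k \<le> r k" for k
    unfolding r_def by (rule member_le_sum) auto
  have r_mono: "r k \<le> r l" if "k \<le> l" for k l
    unfolding r_def using that by (intro sum_mono2) auto
  have sq: "(\<integral>\<^sup>+x. ennreal ((cmod (f m x - f n x))\<^sup>2) \<partial>?M) \<le> ennreal (e\<^sup>2)"
    if "L2_norm \<Omega> (f m - f n) \<le> e" for m n e
  proof -
    have "(\<integral>\<^sup>+x. ennreal ((cmod (f m x - f n x))\<^sup>2) \<partial>?M)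
        = ennreal (LINT x|?M. (cmod (f m x - f n x))\<^sup>2)"
      using L2_sq_integrable[OF L2_diff[OF L2 L2], of m n]
      by (intro nn_integral_eq_integral) (auto simp: fun_diff_def)
    also have "\<dots> = ennreal ((L2_norm \<Omega> (f m - f n))\<^sup>2)"
      by (simp add: L2_norm_sq)
    also have "\<dots> \<le> ennreal (e\<^sup>2)"
      using that L2_norm_nonneg by (intro ennreal_leI power_mono) auto
    finally show ?thesis .
  qed
  have term_le: "u k \<le> suminf u" for u :: "nat \<Rightarrow> ennreal" and k
    using sum_le_suminf[of u "{k}"] by simp
  define d where "d k x = cmod (f (r (Suc k)) x - f (r k) x)" for k x
  have [measurable]: "d k \<in> borel_measurable ?M" for k
    unfolding d_def by measurable
  have "(\<integral>\<^sup>+x. (\<Sum>k. ennreal (2^k * (d k x)\<^sup>2)) \<partial>?M)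
      = (\<Sum>k. \<integral>\<^sup>+x. ennreal (2^k * (d k x)\<^sup>2) \<partial>?M)"
    by (rule nn_integral_suminf) measurable
  also have "\<dots> \<le> (\<Sum>k. ennreal ((1/8)^k))"
  proof (intro suminf_le allI)
    fix k
    have "L2_norm \<Omega> (f (r (Suc k)) - f (r k)) \<le> (1/4)^k"
      using N[of k "r (Suc k)" "r k"] r_ge[of k] r_mono[of k "Suc k"] by simp
    then have "(\<integral>\<^sup>+x. ennreal ((d k x)\<^sup>2) \<partial>?M) \<le> ennreal (((1/4)^k)\<^sup>2)"
      unfolding d_def by (rule sq)
    then have "(\<integral>\<^sup>+x. ennreal (2^k * (d k x)\<^sup>2) \<partial>?M) \<le> ennreal (2^k) * ennreal (((1/4)^k)\<^sup>2)"
      by (simp add: ennreal_mult nn_integral_cmult mult_left_mono)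
    also have "\<dots> = ennreal (2^k * ((1/4)^k)\<^sup>2)"
      by (simp add: ennreal_mult)
    also have "2^k * ((1/4)^k)\<^sup>2 = (1/8::real)^k"
      by (simp add: power2_eq_square power_mult_distrib[symmetric])
    finally show "(\<integral>\<^sup>+x. ennreal (2^k * (d k x)\<^sup>2) \<partial>?M) \<le> ennreal ((1/8)^k)" .
  qed auto
  also have "\<dots> = ennreal (\<Sum>k. (1/8::real)^k)"
    by (intro suminf_ennreal2) (auto simp: summable_geometric)
  also have "\<dots> < \<infinity>" by simp
  finally have "AE x in ?M. (\<Sum>k. ennreal (2^k * (d k x)\<^sup>2)) \<noteq> \<infinity>"
    by (intro nn_integral_PInf_AE) auto
  then have conv: "AE x in ?M. convergent (\<lambda>k. f (r k) x)"
  proof eventually_elim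
    case (elim x)
    define C where "C = enn2real (\<Sum>k. ennreal (2^k * (d k x)\<^sup>2))"
    have "d k x \<le> sqrt C * (1 / sqrt 2)^k" for k
    proof -
      have "ennreal (2^k * (d k x)\<^sup>2) \<le> (\<Sum>k. ennreal (2^k * (d k x)\<^sup>2))"
        by (rule term_le)
      also have "\<dots> = ennreal C"
        using elim by (simp add: C_def less_top)
      finally have "2^k * (d k x)\<^sup>2 \<le> C"
        by (subst (asm) ennreal_le_iff) (auto simp: C_def)
      then have "(d k x)\<^sup>2 \<le> C * (1/2)^k"
        by (simp add: field_simps power_divide)
      then have "sqrt ((d k x)\<^sup>2) \<le> sqrt (C * (1/2)^k)"
        by (rule real_sqrt_le_mono)
      then show ?thesis
        by (simp add: d_def real_sqrt_mult real_sqrt_power real_sqrt_divide)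
    qed
    moreover have "summable (\<lambda>k. sqrt C * (1 / sqrt 2)^k)"
      by (intro summable_mult summable_geometric) simp
    ultimately have "summable (\<lambda>k. d k x)"
      by - (rule summable_comparison_test'[where N = 0], assumption, simp add: d_def)
    then have "summable (\<lambda>k. f (r (Suc k)) x - f (r k) x)"
      unfolding d_def by (rule summable_norm_cancel)
    then have "convergent (\<lambda>n. \<Sum>k<n. f (r (Suc k)) x - f (r k) x)"
      by (simp add: summable_iff_convergent)
    then have "convergent (\<lambda>n. f (r n) x - f (r 0) x)"
      using sum_lessThan_telescope[of "\<lambda>k. f (r k) x"] by simp
    from convergent_add[OF this convergent_const[of "f (r 0) x"]] show ?case by simp
  qed
  define g where "g x = lim (\<lambda>k. f (r k) x)" for x
  have [measurable]: "g \<in> borel_measurable ?M"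
    unfolding g_def by measurable
  have fatou: "(\<integral>\<^sup>+x. ennreal ((cmod (f m x - g x))\<^sup>2) \<partial>?M) \<le> ennreal (e\<^sup>2)"
    if "\<And>k. k \<ge> K \<Longrightarrow> L2_norm \<Omega> (f m - f (r k)) \<le> e" for m K e
  proof -
    have "(\<integral>\<^sup>+x. ennreal ((cmod (f m x - g x))\<^sup>2) \<partial>?M)
        = (\<integral>\<^sup>+x. liminf (\<lambda>k. ennreal ((cmod (f m x - f (r k) x))\<^sup>2)) \<partial>?M)"
    proof (rule nn_integral_cong_AE)
      show "AE x in ?M. ennreal ((cmod (f m x - g x))\<^sup>2)
          = liminf (\<lambda>k. ennreal ((cmod (f m x - f (r k) x))\<^sup>2))"
        using conv
      proof eventually_elim
        case (elim x)
        then have "(\<lambda>k. f (r k) x) \<longlonglongrightarrow> g x"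
          unfolding g_def by (rule convergent_LIMSEQ_iff[THEN iffD1])
        then have "(\<lambda>k. ennreal ((cmod (f m x - f (r k) x))\<^sup>2)) \<longlonglongrightarrow> ennreal ((cmod (f m x - g x))\<^sup>2)"
          by (intro tendsto_ennrealI tendsto_intros)
        then show ?case
          by (intro lim_imp_Liminf[symmetric]) auto
      qed
    qed
    also have "\<dots> \<le> liminf (\<lambda>k. \<integral>\<^sup>+x. ennreal ((cmod (f m x - f (r k) x))\<^sup>2) \<partial>?M)"
      by (intro nn_integral_liminf) measurable
    also have "\<dots> \<le> liminf (\<lambda>k. ennreal (e\<^sup>2))"
      using that by (intro Liminf_mono eventually_sequentiallyI[of K] sq)
    also have "\<dots> = ennreal (e\<^sup>2)"
      by (simp add: Liminf_const)
    finally show ?thesis .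
  qed
  have tail: "f m - g \<in> L2 \<Omega> \<and> L2_norm \<Omega> (f m - g) \<le> (1/4)^K" if "m \<ge> N K" for m K
  proof -
    have "L2_norm \<Omega> (f m - f (r k)) \<le> (1/4)^K" if "k \<ge> K" for k
      using N[OF \<open>m \<ge> N K\<close>, of "r k"] r_ge[of K] r_mono[OF that] by simp
    then have le: "(\<integral>\<^sup>+x. ennreal ((cmod (f m x - g x))\<^sup>2) \<partial>?M) \<le> ennreal (((1/4)^K)\<^sup>2)"
      by (rule fatou)
    also have "\<dots> < \<infinity>" by simp
    finally have int: "integrable ?M (\<lambda>x. (cmod (f m x - g x))\<^sup>2)"
      by (intro integrableI_bounded) auto
    have "ennreal ((L2_norm \<Omega> (f m - g))\<^sup>2) = (\<integral>\<^sup>+x. ennreal ((cmod (f m x - g x))\<^sup>2) \<partial>?M)"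
      using int by (simp add: L2_norm_sq nn_integral_eq_integral)
    also note le
    finally have "(L2_norm \<Omega> (f m - g))\<^sup>2 \<le> ((1/4)^K)\<^sup>2"
      by (subst (asm) ennreal_le_iff) auto
    then have "L2_norm \<Omega> (f m - g) \<le> (1/4)^K"
      by (rule power2_le_imp_le) simp
    with int show ?thesis by (simp add: L2_def fun_diff_def)
  qed
  \<comment> \<open>As a difference of two members of the space, the limit belongs to it.\<close>
  have "f (N 0) - g \<in> L2 \<Omega>"
    using tail[of 0 "N 0"] by simp
  then have "f (N 0) - (f (N 0) - g) \<in> L2 \<Omega>"
    by (rule L2_diff[OF L2])
  then have "g \<in> L2 \<Omega>"
    by (simp add: fun_diff_def)
  moreover have "(\<lambda>m. L2_norm \<Omega> (f m - g)) \<longlonglongrightarrow> 0"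
  proof (rule LIMSEQ_I)
    fix e :: real assume "e > 0"
    then obtain K where "(1/4)^K < e"
      using real_arch_pow_inv[of e "1/4"] by auto
    then show "\<exists>N. \<forall>m\<ge>N. norm (L2_norm \<Omega> (f m - g) - 0) < e"
      using tail L2_norm_nonneg[of \<Omega>]
      by (intro exI[of _ "N K"]) (auto intro: order.strict_trans1)
  qed
  ultimately show thesis by (rule that)
qed

lemma L2n_norm_L2_set: "L2n_norm \<Omega> q = L2_set (\<lambda>j. L2_norm \<Omega> (q $ j)) UNIV"
  by (simp add: L2n_norm_def L2_set_def)

lemma L2n_norm_nonneg: "0 \<le> L2n_norm \<Omega> q"
  by (simp add: L2n_norm_def sum_nonneg)

lemma L2_norm_component_le: "L2_norm \<Omega> (q $ j) \<le> L2n_norm \<Omega> q"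
  unfolding L2n_norm_L2_set by (rule member_le_L2_set) auto

lemma L2n_norm_sq: "(L2n_norm \<Omega> q)\<^sup>2 = (\<Sum>j\<in>UNIV. (L2_norm \<Omega> (q $ j))\<^sup>2)"
  by (simp add: L2n_norm_def sum_nonneg)

lemma L2n_Cauchy_Schwarz:
  assumes "q \<in> L2n \<Omega>" "r \<in> L2n \<Omega>"
  shows "cmod (L2n_inner \<Omega> q r) \<le> L2n_norm \<Omega> q * L2n_norm \<Omega> r"
proof -
  have "cmod (L2n_inner \<Omega> q r) \<le> (\<Sum>j\<in>UNIV. cmod (L2_inner \<Omega> (q $ j) (r $ j)))"
    unfolding L2n_inner_def by (rule norm_sum)
  also have "\<dots> \<le> (\<Sum>j\<in>UNIV. \<bar>L2_norm \<Omega> (q $ j)\<bar> * \<bar>L2_norm \<Omega> (r $ j)\<bar>)"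
    using assms by (intro sum_mono) (simp add: L2n_def L2_Cauchy_Schwarz L2_norm_nonneg)
  also have "\<dots> \<le> L2n_norm \<Omega> q * L2n_norm \<Omega> r"
    unfolding L2n_norm_L2_set by (rule L2_set_mult_ineq)
  finally show ?thesis .
qed

lemma L2n_norm_triangle_componentwise:
  assumes "\<And>j. L2_norm \<Omega> (q $ j) \<le> a * L2_norm \<Omega> (r $ j) + L2_norm \<Omega> (s $ j)" "0 \<le> a"
  shows "L2n_norm \<Omega> q \<le> a * L2n_norm \<Omega> r + L2n_norm \<Omega> s"
proof -
  have "L2n_norm \<Omega> q \<le> L2_set (\<lambda>j. a * L2_norm \<Omega> (r $ j) + L2_norm \<Omega> (s $ j)) UNIV"
    unfolding L2n_norm_L2_set by (intro L2_set_mono assms L2_norm_nonneg)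
  also have "\<dots> \<le> L2_set (\<lambda>j. a * L2_norm \<Omega> (r $ j)) UNIV + L2n_norm \<Omega> s"
    unfolding L2n_norm_L2_set by (rule L2_set_triangle_ineq)
  finally show ?thesis
    using \<open>0 \<le> a\<close> by (simp add: L2n_norm_L2_set L2_set_right_distrib)
qed

section \<open>Test functions\<close>

lemma classical_partial_eq:
  "(f has_derivative D) (at x) \<Longrightarrow> classical_partial k f x = D (axis k 1)"
  by (simp add: classical_partial_def frechet_derivative_at[symmetric])

lemma classical_partial_add:
  assumes "f differentiable (at x)" "g differentiable (at x)"
  shows "classical_partial k (\<lambda>x. f x + g x) x = classical_partial k f x + classical_partial k g x"
  using classical_partial_eq[OF has_derivative_add[OF assms[unfolded frechet_derivative_works]], of k]
  by (simp add: classical_partial_def)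

lemma classical_partial_mult:
  assumes "f differentiable (at x)" "g differentiable (at x)"
  shows "classical_partial k (\<lambda>x. f x * g x) x = f x * classical_partial k g x + classical_partial k f x * g x"
  using classical_partial_eq[OF has_derivative_mult[OF assms[unfolded frechet_derivative_works]], of k]
  by (simp add: classical_partial_def)

lemma classical_partial_const: "classical_partial k (\<lambda>x. c) x = 0"
  by (rule classical_partial_eq) simp

lemma classical_partial_scale:
  assumes "f differentiable (at x)"
  shows "classical_partial k (\<lambda>x. c * f x) x = c * classical_partial k f x"
  using assms by (simp add: classical_partial_mult classical_partial_const)

lemma classical_partial_cnj:
  assumes "f differentiable (at x)"
  shows "classical_partial k (\<lambda>x. cnj (f x)) x = cnj (classical_partial k f x)"
  using classical_partial_eq[OF bounded_linear.has_derivative[OF bounded_linear_cnj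
      assms[unfolded frechet_derivative_works]], of k]
  by (simp add: classical_partial_def)

lemma smooth_differentiable: "smooth f \<Longrightarrow> f differentiable (at x)"
  unfolding smooth_def by (drule spec[of _ "[]"]) simp

lemma smooth_classical_partial: "smooth f \<Longrightarrow> smooth (classical_partial k f)"
  unfolding smooth_def
proof (intro allI)
  fix ks x assume "\<forall>ks x. fold classical_partial ks f differentiable (at x)"
  from this[rule_format, of "k # ks" x]
  show "fold classical_partial ks (classical_partial k f) differentiable (at x)" by simp
qed

lemma smooth_continuous: "smooth f \<Longrightarrow> continuous_on UNIV f"
  by (simp add: continuous_at_imp_continuous_on differentiable_imp_continuous_within
      smooth_differentiable)

lemma smooth_add:
  assumes "smooth f" "smooth g"
  shows "smooth (\<lambda>x. f x + g x)"
proof -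
  have "fold classical_partial ks (\<lambda>x. f x + g x) differentiable (at x)"
    if "smooth f" "smooth g" for ks f g x
    using that
  proof (induction ks arbitrary: f g)
    case Nil
    then show ?case by (simp add: smooth_differentiable)
  next
    case (Cons k ks)
    have "classical_partial k (\<lambda>x. f x + g x) = (\<lambda>x. classical_partial k f x + classical_partial k g x)"
      using Cons.prems by (simp add: fun_eq_iff classical_partial_add smooth_differentiable)
    then show ?case
      using Cons by (simp add: smooth_classical_partial)
  qed
  with assms show ?thesis unfolding smooth_def[of "\<lambda>x. f x + g x"] by blast
qed

lemma smooth_scale:
  assumes "smooth f"
  shows "smooth (\<lambda>x. c * f x)"
proof -
  have "fold classical_partial ks (\<lambda>x. c * f x) differentiable (at x)"
    if "smooth f" for ks f x
    using that
  proof (induction ks arbitrary: f)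
    case Nil
    then show ?case by (simp add: smooth_differentiable)
  next
    case (Cons k ks)
    have "classical_partial k (\<lambda>x. c * f x) = (\<lambda>x. c * classical_partial k f x)"
      using Cons.prems by (simp add: fun_eq_iff classical_partial_scale smooth_differentiable)
    then show ?case
      using Cons by (simp add: smooth_classical_partial)
  qed
  with assms show ?thesis unfolding smooth_def[of "\<lambda>x. c * f x"] by blast
qed

lemma support_within_compactI:
  fixes K :: "'a::t2_space set"
  assumes "compact K" "K \<subseteq> \<Omega>" "\<And>x. x \<notin> K \<Longrightarrow> f x = 0"
  shows "compact (closure {x. f x \<noteq> 0})" "closure {x. f x \<noteq> 0} \<subseteq> \<Omega>"
proof -
  have "closure {x. f x \<noteq> 0} \<subseteq> K"
    using assms by (intro closure_minimal compact_imp_closed) auto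
  then show "closure {x. f x \<noteq> 0} \<subseteq> \<Omega>" "compact (closure {x. f x \<noteq> 0})"
    using assms compact_Int_closed[OF \<open>compact K\<close>, of "closure {x. f x \<noteq> 0}"]
    by (auto simp: Int_absorb1)
qed

lemma test_functionsI:
  assumes "smooth f" "compact K" "K \<subseteq> \<Omega>" "\<And>x. x \<notin> K \<Longrightarrow> f x = 0"
  shows "f \<in> test_functions \<Omega>"
  using assms(1) support_within_compactI[OF assms(2-4)] by (simp add: test_functions_def)

lemma test_functions_support:
  assumes "\<phi> \<in> test_functions \<Omega>"
  obtains K where "compact K" "K \<subseteq> \<Omega>" "\<And>x. x \<notin> K \<Longrightarrow> \<phi> x = 0"
    "\<And>k x. x \<notin> K \<Longrightarrow> classical_partial k \<phi> x = 0"
proof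
  let ?K = "closure {x. \<phi> x \<noteq> 0}"
  show "compact ?K" "?K \<subseteq> \<Omega>"
    using assms by (auto simp: test_functions_def)
  show 0: "\<phi> x = 0" if "x \<notin> ?K" for x
    using that closure_subset[of "{x. \<phi> x \<noteq> 0}"] by blast
  show "classical_partial k \<phi> x = 0" if "x \<notin> ?K" for k x
  proof (rule classical_partial_eq)
    show "(\<phi> has_derivative (\<lambda>_. 0)) (at x)"
      using has_derivative_const[of 0 "at x"]
    proof (rule has_derivative_transform_within_open)
      show "open (- ?K)" by (rule open_Compl) (rule closed_closure)
      show "x \<in> - ?K" using that by blast
      show "0 = \<phi> y" if "y \<in> - ?K" for y
        by (rule 0[OF ComplD[OF that], symmetric])
    qed
  qed
qed

lemma test_functions_smooth: "\<phi> \<in> test_functions \<Omega> \<Longrightarrow> smooth \<phi>"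
  by (simp add: test_functions_def)

lemma test_functions_mono: "U \<subseteq> \<Omega> \<Longrightarrow> test_functions U \<subseteq> test_functions \<Omega>"
  by (auto simp: test_functions_def)

lemma test_functions_add:
  assumes "\<phi> \<in> test_functions \<Omega>" "\<psi> \<in> test_functions \<Omega>"
  shows "(\<lambda>x. \<phi> x + \<psi> x) \<in> test_functions \<Omega>"
proof -
  obtain K L where "compact K" "K \<subseteq> \<Omega>" "\<And>x. x \<notin> K \<Longrightarrow> \<phi> x = 0"
    "compact L" "L \<subseteq> \<Omega>" "\<And>x. x \<notin> L \<Longrightarrow> \<psi> x = 0"
    using assms by (metis test_functions_support)
  then show ?thesis
    using assms
    by (intro test_functionsI[where K = "K \<union> L"])
      (auto intro: smooth_add test_functions_smooth)
qed

lemma test_functions_scale: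
  assumes "\<phi> \<in> test_functions \<Omega>"
  shows "(\<lambda>x. c * \<phi> x) \<in> test_functions \<Omega>"
proof -
  obtain K where "compact K" "K \<subseteq> \<Omega>" "\<And>x. x \<notin> K \<Longrightarrow> \<phi> x = 0"
    using assms by (metis test_functions_support)
  then show ?thesis
    using assms
    by (intro test_functionsI[where K = K]) (auto intro: smooth_scale test_functions_smooth)
qed

lemma test_functions_diff:
  assumes "\<phi> \<in> test_functions \<Omega>" "\<psi> \<in> test_functions \<Omega>"
  shows "\<phi> - \<psi> \<in> test_functions \<Omega>"
  using test_functions_add[OF assms(1) test_functions_scale[OF assms(2), of "-1"]]
  by (simp add: fun_diff_def)

lemma test_functions_classical_partial_add:
  assumes "\<phi> \<in> test_functions \<Omega>" "\<psi> \<in> test_functions \<Omega>"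
  shows "classical_partial k (\<lambda>x. \<phi> x + \<psi> x) = (\<lambda>x. classical_partial k \<phi> x + classical_partial k \<psi> x)"
  using assms by (simp add: fun_eq_iff classical_partial_add smooth_differentiable test_functions_smooth)

lemma test_functions_classical_partial_scale:
  assumes "\<phi> \<in> test_functions \<Omega>"
  shows "classical_partial k (\<lambda>x. c * \<phi> x) = (\<lambda>x. c * classical_partial k \<phi> x)"
  using assms by (simp add: fun_eq_iff classical_partial_scale smooth_differentiable test_functions_smooth)

lemma test_functions_classical_partial_diff:
  assumes "\<phi> \<in> test_functions \<Omega>" "\<psi> \<in> test_functions \<Omega>"
  shows "classical_partial k (\<phi> - \<psi>) = classical_partial k \<phi> - classical_partial k \<psi>"
  using test_functions_classical_partial_add[OF assms(1) test_functions_scale[OF assms(2)], of k "-1"]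
    test_functions_classical_partial_scale[OF assms(2), of k "-1"]
  by (simp add: fun_diff_def)

lemma test_functions_zero: "(\<lambda>x. 0) \<in> test_functions (\<Omega> :: (real^'n::finite) set)"
proof (rule test_functionsI[where K = "{}"])
  have "fold classical_partial ks (\<lambda>x. 0 :: complex) = (\<lambda>x. 0)" for ks :: "'n list"
    by (induction ks) (simp_all add: fun_eq_iff classical_partial_const[abs_def])
  then show "smooth (\<lambda>x::real^'n. 0)"
    by (simp add: smooth_def)
qed auto

section \<open>Smooth approximation of open sets\<close>

text \<open>The case \<open>m = 0\<close> is the classical flat function \<open>exp (-1/t)\<close>. The powers \<open>t\<^sup>-\<^sup>m\<close> are included
  because the derivative of each of these functions is then a linear combination of others, at \<open>0\<close> as
  well; so each of them is smooth.\<close>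

definition flat :: "nat \<Rightarrow> real \<Rightarrow> real" where
  "flat m t = (if t \<le> 0 then 0 else inverse t ^ m * exp (- inverse t))"

lemma flat_tendsto_0: "(flat m \<longlongrightarrow> 0) (at 0)"
proof (rule filterlim_split_at)
  show "(flat m \<longlongrightarrow> 0) (at_left 0)"
    by (rule tendsto_eventually) (auto simp: flat_def eventually_at_filter)
  have "((\<lambda>t. inverse t ^ m / exp (inverse t)) \<longlongrightarrow> (0::real)) (at_right 0)"
    by (rule filterlim_compose[OF tendsto_power_div_exp_0 filterlim_inverse_at_top_right])
  then show "(flat m \<longlongrightarrow> 0) (at_right 0)"
  proof (rule Lim_transform_eventually)
    show "\<forall>\<^sub>F t in at_right 0. inverse t ^ m / exp (inverse t) = flat m t"
      using eventually_at_right_less[of 0]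
      by eventually_elim (auto simp: flat_def exp_minus field_simps)
  qed
qed

lemma flat_derivative:
  "(flat m has_real_derivative - of_nat m * flat (Suc m) t + flat (m + 2) t) (at t)"
proof -
  consider "t < 0" | "t = 0" | "t > 0" by linarith
  then show ?thesis
  proof cases
    case 1
    have "((\<lambda>_. 0) has_real_derivative 0) (at t)" by simp
    then have "(flat m has_real_derivative 0) (at t)"
      by (rule has_field_derivative_transform_within_open[where S = "{..<0}"])
        (use 1 in \<open>auto simp: flat_def\<close>)
    with 1 show ?thesis by (simp add: flat_def)
  next
    case 2
    \<comment> \<open>The difference quotient of \<open>flat m\<close> at \<open>0\<close> is \<open>flat (Suc m)\<close>.\<close>
    have "((\<lambda>h. (flat m (0 + h) - flat m 0) / h) \<longlongrightarrow> 0) (at 0)"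
      using flat_tendsto_0[of "Suc m"]
      by (rule Lim_transform_eventually)
        (auto simp: flat_def eventually_at_filter field_simps)
    then have "(flat m has_real_derivative 0) (at 0)"
      by (simp add: DERIV_def)
    with 2 show ?thesis by (simp add: flat_def)
  next
    case 3
    have "((\<lambda>t. inverse t ^ m * exp (- inverse t)) has_real_derivative
        - of_nat m * flat (Suc m) t + flat (m + 2) t) (at t)"
      using 3 by (auto intro!: derivative_eq_intros simp: flat_def)
        (cases m; simp add: field_simps power2_eq_square)
    then show ?thesis
      by (rule has_field_derivative_transform_within_open[where S = "{0<..}"])
        (use 3 in \<open>auto simp: flat_def\<close>)
  qed
qed

definition ball_bump :: "nat \<Rightarrow> (real^'n) \<Rightarrow> real \<Rightarrow> real^'n \<Rightarrow> real" where
  "ball_bump m a r x = flat m (r\<^sup>2 - (x - a) \<bullet> (x - a))"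

text \<open>Smoothness demands all iterated derivatives at once. It is therefore shown for an algebra of
  functions that contains the bumps, consists of differentiable functions and is mapped into itself by every
  partial derivative. The coordinate functions enter through the derivative of
  \<open>r\<^sup>2 - |x - a|\<^sup>2\<close>.\<close>

inductive_set bump_algebra :: "(real^'n::finite \<Rightarrow> complex) set" where
  bump: "(\<lambda>x. of_real (ball_bump m a r x)) \<in> bump_algebra"
| const: "(\<lambda>x. c) \<in> bump_algebra"
| coord: "(\<lambda>x. of_real (x $ k)) \<in> bump_algebra"
| add: "f \<in> bump_algebra \<Longrightarrow> g \<in> bump_algebra \<Longrightarrow> (\<lambda>x. f x + g x) \<in> bump_algebra"
| mult: "f \<in> bump_algebra \<Longrightarrow> g \<in> bump_algebra \<Longrightarrow> (\<lambda>x. f x * g x) \<in> bump_algebra"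

lemma bump_algebra_partial:
  assumes "f \<in> bump_algebra"
  shows "f differentiable (at x) \<and> classical_partial k f \<in> bump_algebra"
  using assms
proof (induction arbitrary: x)
  case (bump m a r)
  define s where "s y = - of_nat m * ball_bump (Suc m) a r y + ball_bump (m + 2) a r y" for y
  have D: "((\<lambda>x. complex_of_real (ball_bump m a r x)) has_derivative
      (\<lambda>h. of_real (s y * - (2 * ((y - a) \<bullet> h))))) (at y)" for y
  proof -
    have "((\<lambda>x. r\<^sup>2 - (x - a) \<bullet> (x - a)) has_derivative (\<lambda>h. - (2 * ((y - a) \<bullet> h)))) (at y)"
      by (auto intro!: derivative_eq_intros simp: inner_commute)
    from DERIV_compose_FDERIV[OF flat_derivative this]
    have "(ball_bump m a r has_derivative (\<lambda>h. s y * - (2 * ((y - a) \<bullet> h)))) (at y)"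
      unfolding ball_bump_def[abs_def] s_def by (simp add: mult.commute)
    then show ?thesis
      by (rule bounded_linear.has_derivative[OF bounded_linear_of_real])
  qed
  have "classical_partial k (\<lambda>x. complex_of_real (ball_bump m a r x)) =
    (\<lambda>y. ((- of_nat m) * of_real (ball_bump (Suc m) a r y) + of_real (ball_bump (m + 2) a r y))
        * ((- 2) * (of_real (y $ k) + - of_real (a $ k))))"
    by (simp add: fun_eq_iff classical_partial_eq[OF D] s_def inner_axis algebra_simps)
  moreover have "\<dots> \<in> bump_algebra"
    by (intro bump_algebra.intros)
  ultimately show ?case
    using D by (auto simp: differentiable_def)
next
  case (const c)
  then show ?case
    by (simp add: classical_partial_const[abs_def] bump_algebra.const)
next
  case (coord j)
  have D: "((\<lambda>x. complex_of_real (x $ j)) has_derivative (\<lambda>h. of_real (h $ j))) (at y)" for y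
    by (intro bounded_linear_imp_has_derivative bounded_linear_compose[OF bounded_linear_of_real]
        bounded_linear_vec_nth)
  have "classical_partial k (\<lambda>x. complex_of_real (x $ j)) = (\<lambda>y. of_real (axis k 1 $ j))"
    by (simp add: fun_eq_iff classical_partial_eq[OF D])
  then show ?case
    using D by (auto simp: differentiable_def bump_algebra.const)
next
  case (add f g)
  have "classical_partial k (\<lambda>x. f x + g x) = (\<lambda>x. classical_partial k f x + classical_partial k g x)"
    using add.IH by (simp add: fun_eq_iff classical_partial_add)
  then show ?case
    using add by (simp add: bump_algebra.add)
next
  case (mult f g)
  have "classical_partial k (\<lambda>x. f x * g x)
      = (\<lambda>x. f x * classical_partial k g x + classical_partial k f x * g x)"
    using mult.IH by (simp add: fun_eq_iff classical_partial_mult)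
  then show ?case
    using mult by (simp add: bump_algebra.intros)
qed

lemma bump_algebra_smooth:
  assumes "f \<in> bump_algebra"
  shows "smooth f"
proof -
  have "fold classical_partial ks f \<in> bump_algebra" for ks
    using assms by (induction ks arbitrary: f) (simp_all add: bump_algebra_partial)
  then show ?thesis
    by (simp add: smooth_def bump_algebra_partial)
qed

lemma bump_algebra_power: "f \<in> bump_algebra \<Longrightarrow> (\<lambda>x. f x ^ m) \<in> bump_algebra"
  by (induction m) (simp_all add: bump_algebra.intros)

lemma bump_algebra_prod:
  "(\<And>i. f i \<in> bump_algebra) \<Longrightarrow> (\<lambda>x. \<Prod>i<m. f i x) \<in> bump_algebra" for m :: nat
  by (induction m) (simp_all add: bump_algebra.intros)

lemma ball_bump_0_bounds: "0 \<le> ball_bump 0 a r x" "ball_bump 0 a r x < 1"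
  by (auto simp: ball_bump_def flat_def)

lemma ball_bump_0_pos_iff:
  assumes "r > 0"
  shows "0 < ball_bump 0 a r x \<longleftrightarrow> x \<in> ball a r"
proof -
  have "0 < ball_bump 0 a r x \<longleftrightarrow> (norm (x - a))\<^sup>2 < r\<^sup>2"
    by (auto simp: ball_bump_def flat_def dot_square_norm)
  also have "\<dots> \<longleftrightarrow> x \<in> ball a r"
    using assms power_strict_mono[of "norm (x - a)" r 2]
      power_less_imp_less_base[of "norm (x - a)" 2 r]
    by (auto simp: dist_norm norm_minus_commute)
  finally show ?thesis .
qed

lemma open_as_union_of_balls:
  fixes U :: "'a::{heine_borel, second_countable_topology} set"
  assumes "open U" "U \<noteq> {}"
  obtains a and r :: "nat \<Rightarrow> real" where "\<And>i. 0 < r i" "\<And>i. cball (a i) (r i) \<subseteq> U"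
    "U = (\<Union>i. ball (a i) (r i))"
proof -
  define F where "F = {ball a r | a r. 0 < r \<and> cball a r \<subseteq> U}"
  have "\<And>S. S \<in> F \<Longrightarrow> open S"
    by (auto simp: F_def)
  then obtain F' where F': "F' \<subseteq> F" "countable F'" "\<Union>F' = \<Union>F"
    by (rule Lindelof)
  have UF: "\<Union>F = U"
  proof
    show "\<Union>F \<subseteq> U"
      unfolding F_def by (force dest: subsetD[OF ball_subset_cball])
    show "U \<subseteq> \<Union>F"
    proof
      fix x assume "x \<in> U"
      then obtain e where "0 < e" "cball x e \<subseteq> U"
        using \<open>open U\<close> open_contains_cball by blast
      then show "x \<in> \<Union>F"
        unfolding F_def by (intro UnionI[of "ball x e"]) auto
    qed
  qed
  with F' \<open>U \<noteq> {}\<close> have "F' \<noteq> {}" by auto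
  have "\<forall>i. \<exists>a r. from_nat_into F' i = ball a r \<and> 0 < r \<and> cball a r \<subseteq> U"
    using from_nat_into[OF \<open>F' \<noteq> {}\<close>] F'(1) by (auto simp: F_def subset_iff)
  then obtain a r where ar: "\<And>i. from_nat_into F' i = ball (a i) (r i) \<and> 0 < r i \<and> cball (a i) (r i) \<subseteq> U"
    by metis
  have "(\<Union>i. ball (a i) (r i)) = (\<Union>i. from_nat_into F' i)"
    using ar by simp
  also have "\<dots> = U"
    using F' UF range_from_nat_into[OF \<open>F' \<noteq> {}\<close> \<open>countable F'\<close>] by simp
  finally show thesis
    using ar by (intro that[of r a]) auto
qed

text \<open>Let \<open>U\<close> be the union of balls \<open>K\<^sub>i\<close> whose closures lie in \<open>U\<close>, and let the bump \<open>b\<^sub>i\<close> take values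
  in \<open>[0, 1)\<close> and be positive exactly on \<open>K\<^sub>i\<close>. Then \<open>\<Prod>\<^sub>i\<^sub><\<^sub>m (1 - b\<^sub>i)\<^sup>m\<close> equals \<open>1\<close> off \<open>U\<close>, and at a
  point of \<open>U\<close> one of its factors is, for large \<open>m\<close>, the \<open>m\<close>-th power of a fixed number below \<open>1\<close>. So its complement to
  \<open>1\<close> converges to the indicator of \<open>U\<close>.\<close>

lemma test_functions_approximate_open:
  fixes U :: "(real^'n::finite) set"
  assumes "open U"
  obtains \<psi> :: "nat \<Rightarrow> real^'n \<Rightarrow> real"
  where "\<And>m. (\<lambda>x. of_real (\<psi> m x)) \<in> test_functions U"
    and "\<And>m x. 0 \<le> \<psi> m x \<and> \<psi> m x \<le> 1"
    and "\<And>x. (\<lambda>m. \<psi> m x) \<longlonglongrightarrow> indicator U x"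
proof (cases "U = {}")
  case True
  then show thesis
    using that[of "\<lambda>_ _. 0"] by (simp add: test_functions_zero)
next
  case False
  obtain a and r :: "nat \<Rightarrow> real" where r: "\<And>i. 0 < r i" "\<And>i. cball (a i) (r i) \<subseteq> U"
    and U: "U = (\<Union>i. ball (a i) (r i))"
    using open_as_union_of_balls[OF \<open>open U\<close> False] by metis
  define c where "c i x = 1 - ball_bump 0 (a i) (r i) x" for i x
  have c: "0 < c i x" "c i x \<le> 1" for i x
    using ball_bump_0_bounds[of "a i" "r i" x] by (auto simp: c_def)
  have c1: "c i x < 1 \<longleftrightarrow> x \<in> ball (a i) (r i)" for i x
    using ball_bump_0_pos_iff[OF r(1)] by (simp add: c_def)
  define \<psi> where "\<psi> m x = 1 - (\<Prod>i<m. c i x) ^ m" for m x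
  have prod: "0 \<le> (\<Prod>i<m. c i x)" "(\<Prod>i<m. c i x) \<le> 1" for m x
    using c by (auto intro!: prod_nonneg prod_le_1 simp: less_imp_le)
  show thesis
  proof (rule that[of \<psi>])
    fix m x
    show "0 \<le> \<psi> m x \<and> \<psi> m x \<le> 1"
      using prod[where m = m and x = x] by (simp add: \<psi>_def power_le_one)
    show "(\<lambda>x. complex_of_real (\<psi> m x)) \<in> test_functions U"
    proof (rule test_functionsI)
      have "(\<lambda>x. 1 + (- 1) * (\<Prod>i<m. 1 + (- 1) * of_real (ball_bump 0 (a i) (r i) x)) ^ m) \<in> bump_algebra"
        by (intro bump_algebra.intros bump_algebra_power bump_algebra_prod)
      then show "smooth (\<lambda>x. complex_of_real (\<psi> m x))"
        by (intro bump_algebra_smooth) (simp add: \<psi>_def c_def)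
      show "compact (\<Union>i<m. cball (a i) (r i))"
        by (intro compact_UN) auto
      show "(\<Union>i<m. cball (a i) (r i)) \<subseteq> U"
        using r by blast
      show "complex_of_real (\<psi> m x) = 0" if "x \<notin> (\<Union>i<m. cball (a i) (r i))" for x
      proof -
        have "c i x = 1" if "i < m" for i
          using c1[of i x] c(2)[of i x] \<open>x \<notin> _\<close> that by force
        then show ?thesis by (simp add: \<psi>_def)
      qed
    qed
  next
    fix x
    show "(\<lambda>m. \<psi> m x) \<longlonglongrightarrow> indicator U x"
    proof (cases "x \<in> U")
      case True
      then obtain i where "c i x < 1"
        using c1 U by blast
      then have lim: "(\<lambda>m. c i x ^ m) \<longlonglongrightarrow> 0"
        using c(1)[of i x] by (intro LIMSEQ_power_zero) simp
      have "(\<lambda>m. (\<Prod>i<m. c i x) ^ m) \<longlonglongrightarrow> 0"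
      proof (rule Lim_null_comparison[OF _ lim])
        have "(\<Prod>i<m. c i x) \<le> c i x" if "m > i" for m
        proof -
          have "(\<Prod>j<m. c j x) = c i x * (\<Prod>j\<in>{..<m} - {i}. c j x)"
            using that by (intro prod.remove) auto
          also have "\<dots> \<le> c i x * 1"
            using c by (intro mult_left_mono prod_le_1) (auto simp: less_imp_le)
          finally show ?thesis by simp
        qed
        then show "\<forall>\<^sub>F m in sequentially. norm ((\<Prod>i<m. c i x) ^ m) \<le> c i x ^ m"
          using prod by (intro eventually_sequentiallyI[of "Suc i"]) (auto intro!: power_mono)
      qed
      then show ?thesis
        using tendsto_diff[OF tendsto_const[of 1]] True by (fastforce simp: \<psi>_def)
    next
      case False
      then have "c i x = 1" for i
        using c1[of i x] c(2)[of i x] U by force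
      with False show ?thesis by (simp add: \<psi>_def)
    qed
  qed
qed

section \<open>The fundamental lemma of the calculus of variations\<close>

lemma integral_lebesgue_on_supported:
  fixes f :: "real^'n \<Rightarrow> 'b::{banach, second_countable_topology}"
  assumes "\<Omega> \<in> sets lebesgue" "f \<in> borel_measurable borel" "\<And>x. x \<notin> \<Omega> \<Longrightarrow> f x = 0"
  shows "integral\<^sup>L (lebesgue_on \<Omega>) f = integral\<^sup>L lborel f"
proof -
  have "integral\<^sup>L (lebesgue_on \<Omega>) f = integral\<^sup>L lebesgue (\<lambda>x. indicator \<Omega> x *\<^sub>R f x)"
    using assms(1) by (simp add: integral_restrict_space)
  also have "(\<lambda>x. indicator \<Omega> x *\<^sub>R f x) = f"
    using assms(3) by (auto simp: fun_eq_iff indicator_def)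
  also have "integral\<^sup>L lebesgue f = integral\<^sup>L lborel f"
    using assms(2) by (intro integral_completion) simp
  finally show ?thesis .
qed

lemma continuous_compact_support_integrable:
  fixes f :: "real^'n \<Rightarrow> 'b::{banach, second_countable_topology}"
  assumes "continuous_on UNIV f" "compact K" "\<And>x. x \<notin> K \<Longrightarrow> f x = 0"
  shows "integrable lborel f"
proof -
  have "integrable lborel (\<lambda>x. indicator K x *\<^sub>R f x)"
    using assms(1,2) by (intro borel_integrable_compact) (auto intro: continuous_on_subset)
  also have "(\<lambda>x. indicator K x *\<^sub>R f x) = f"
    using assms(3) by (auto simp: fun_eq_iff indicator_def)
  finally show ?thesis .
qed

lemma continuous_compact_support_L2:
  fixes f :: "real^'n \<Rightarrow> complex"
  assumes \<Omega>: "\<Omega> \<in> sets lebesgue"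
    and f: "continuous_on UNIV f" "compact K" "\<And>x. x \<notin> K \<Longrightarrow> f x = 0"
  shows "f \<in> L2 \<Omega>"
proof -
  have "integrable lborel (\<lambda>x. (cmod (f x))\<^sup>2)"
    using f by (intro continuous_compact_support_integrable[where K = K] continuous_intros) auto
  moreover have "(\<lambda>x. (cmod (f x))\<^sup>2) \<in> borel_measurable lborel"
    using f(1) by (auto intro!: borel_measurable_continuous_onI continuous_intros)
  ultimately have "integrable lebesgue (\<lambda>x. (cmod (f x))\<^sup>2)"
    by (simp add: integrable_completion)
  then have "integrable lebesgue (\<lambda>x. indicator \<Omega> x *\<^sub>R (cmod (f x))\<^sup>2)"
    by (rule integrable_mult_indicator[OF \<Omega>])
  then have "integrable (lebesgue_on \<Omega>) (\<lambda>x. (cmod (f x))\<^sup>2)"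
    using \<Omega> by (simp add: integrable_restrict_space)
  moreover have "f \<in> borel_measurable (lebesgue_on \<Omega>)"
    using f(1) \<Omega> by (intro continuous_imp_measurable_on_sets_lebesgue) (auto intro: continuous_on_subset)
  ultimately show ?thesis by (simp add: L2_def)
qed

lemma test_functions_L2:
  fixes \<Omega> :: "(real^'n::finite) set"
  assumes "open \<Omega>" "\<phi> \<in> test_functions \<Omega>"
  shows "\<phi> \<in> L2 \<Omega>"
proof -
  obtain K where "compact K" "\<And>x. x \<notin> K \<Longrightarrow> \<phi> x = 0"
    using test_functions_support[OF assms(2)] by metis
  then show ?thesis
    using assms by (intro continuous_compact_support_L2)
      (auto intro: smooth_continuous test_functions_smooth)
qed

lemma test_functions_partial_L2:
  fixes \<Omega> :: "(real^'n::finite) set"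
  assumes "open \<Omega>" "\<phi> \<in> test_functions \<Omega>"
  shows "classical_partial k \<phi> \<in> L2 \<Omega>"
proof -
  obtain K where "compact K" "\<And>x. x \<notin> K \<Longrightarrow> classical_partial k \<phi> x = 0"
    using test_functions_support[OF assms(2)] by metis
  then show ?thesis
    using assms by (intro continuous_compact_support_L2)
      (auto intro: smooth_continuous smooth_classical_partial test_functions_smooth)
qed

text \<open>Boundedness of \<open>V\<close> makes \<open>1 + |z|\<^sup>2\<close> integrable over \<open>V\<close>; it dominates the products of \<open>z\<close> with the
  test functions that approximate the indicator of \<open>V\<close>.\<close>

lemma orthogonal_imp_integral_open_zero:
  fixes \<Omega> :: "(real^'n::finite) set"
  assumes "open \<Omega>" "z \<in> L2 \<Omega>"
    and orth: "\<And>\<phi>. \<phi> \<in> test_functions \<Omega> \<Longrightarrow> L2_inner \<Omega> z \<phi> = 0"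
    and V: "open V" "bounded V" "V \<subseteq> \<Omega>"
  shows "integrable (lebesgue_on \<Omega>) (\<lambda>x. indicator V x * cnj (z x))"
    and "(LINT x|lebesgue_on \<Omega>. indicator V x * cnj (z x)) = 0"
proof -
  let ?M = "lebesgue_on \<Omega>"
  have [measurable]: "z \<in> borel_measurable ?M"
    using \<open>z \<in> L2 \<Omega>\<close> by (rule L2_measurable)
  have [measurable]: "V \<in> sets ?M"
    using V \<open>open \<Omega>\<close> by (simp add: sets_restrict_space_iff)
  obtain \<psi> :: "nat \<Rightarrow> real^'n \<Rightarrow> real" where
    \<psi>: "\<And>m. (\<lambda>x. complex_of_real (\<psi> m x)) \<in> test_functions V"
    and bounds: "\<And>m x. 0 \<le> \<psi> m x \<and> \<psi> m x \<le> 1"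
    and lim: "\<And>x. (\<lambda>m. \<psi> m x) \<longlonglongrightarrow> indicator V x"
    using test_functions_approximate_open[OF V(1)] by metis
  have test: "(\<lambda>x. complex_of_real (\<psi> m x)) \<in> test_functions \<Omega>" for m
    using \<psi> test_functions_mono[OF V(3)] by blast
  have [measurable]: "(\<lambda>x. complex_of_real (\<psi> m x)) \<in> borel_measurable ?M" for m
    using test_functions_L2[OF \<open>open \<Omega>\<close> test] by (rule L2_measurable)
  have supp: "\<psi> m x \<le> indicator V x" for m x
  proof (cases "x \<in> V")
    case False
    then show ?thesis
      using test_functions_support[OF \<psi>[of m]] by (metis of_real_eq_0_iff subsetD indicator_simps(2) order_refl)
  qed (use bounds in simp)
  have "emeasure ?M V < \<infinity>"
    using V \<open>open \<Omega>\<close> emeasure_bounded_finite[OF V(2)] by (simp add: emeasure_restrict_space)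
  then have w: "integrable ?M (\<lambda>x. indicator V x * (1 + (cmod (z x))\<^sup>2))"
    unfolding distrib_left mult_1_right
    using integrable_mult_indicator[OF \<open>V \<in> sets ?M\<close> L2_sq_integrable[OF \<open>z \<in> L2 \<Omega>\<close>]]
    using V(3) by (intro Bochner_Integration.integrable_add)
      (auto simp: integrable_indicator_iff Int_absorb2)
  have sq: "cmod (z x) \<le> 1 + (cmod (z x))\<^sup>2" for x
    using sum_squares_bound[of 1 "cmod (z x)"] norm_ge_zero[of "z x"]
    by (simp only: power_one mult_1_right)
  have le: "t * cmod (z x) \<le> indicator V x * (1 + (cmod (z x))\<^sup>2)" if "0 \<le> t" "t \<le> indicator V x" for t x
    using that sq by (intro mult_mono) auto
  have "(\<lambda>m. LINT x|?M. cnj (z x) * of_real (\<psi> m x)) \<longlonglongrightarrow> (LINT x|?M. indicator V x * cnj (z x))"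
  proof (rule integral_dominated_convergence[OF _ _ w])
    show "AE x in ?M. (\<lambda>m. cnj (z x) * of_real (\<psi> m x)) \<longlonglongrightarrow> indicator V x * cnj (z x)"
    proof (intro AE_I2)
      fix x
      have "(\<lambda>m. cnj (z x) * complex_of_real (\<psi> m x)) \<longlonglongrightarrow> cnj (z x) * of_real (indicator V x)"
        by (intro tendsto_intros lim)
      then show "(\<lambda>m. cnj (z x) * of_real (\<psi> m x)) \<longlonglongrightarrow> indicator V x * cnj (z x)"
        by (cases "x \<in> V") (simp_all add: mult.commute)
    qed
    show "AE x in ?M. norm (cnj (z x) * of_real (\<psi> m x)) \<le> indicator V x * (1 + (cmod (z x))\<^sup>2)" for m
      using le[OF conjunct1[OF bounds] supp] bounds
      by (simp add: norm_mult mult.commute)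
  qed measurable
  moreover have "(LINT x|?M. cnj (z x) * of_real (\<psi> m x)) = 0" for m
    using orth[OF test] by (simp add: L2_inner_def)
  ultimately show "(LINT x|?M. indicator V x * cnj (z x)) = 0"
    by (simp add: LIMSEQ_const_iff)
  show "integrable ?M (\<lambda>x. indicator V x * cnj (z x))"
    by (rule Bochner_Integration.integrable_bound[OF w])
      (use sq in \<open>auto simp: norm_mult indicator_def\<close>)
qed

lemma sigma_finite_lebesgue_on:
  fixes S :: "(real^'n) set"
  assumes "S \<in> sets lebesgue"
  shows "sigma_finite_measure (lebesgue_on S)"
proof -
  have "sigma_finite_measure (lebesgue :: (real^'n) measure)"
  proof
    let ?A = "range (\<lambda>m::nat. ball 0 (real m) :: (real^'n) set)"
    have "\<Union>?A = UNIV"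
      using reals_Archimedean2 by (auto simp: dist_norm)
    moreover have "\<forall>a\<in>?A. emeasure lebesgue a \<noteq> \<infinity>"
      using emeasure_bounded_finite[OF bounded_ball] by (auto simp: less_top[symmetric])
    ultimately show "\<exists>A. countable A \<and> A \<subseteq> sets lebesgue \<and> \<Union>A = space lebesgue
        \<and> (\<forall>a\<in>A. emeasure (lebesgue :: (real^'n) measure) a \<noteq> \<infinity>)"
      by (intro exI[of _ ?A]) auto
  qed
  then show ?thesis
    using assms by (rule sigma_finite_measure_restrict_space)
qed

text \<open>Outer regularity carries the vanishing of the integrals from open sets to measurable sets: a
  measurable \<open>A\<close> differs by a null set from the intersection of a sequence of open sets, whose finite
  intersections are again open. The balls of integer radius only serve to make the open sets bounded.\<close>

lemma L2_orthogonal_to_test_functions: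
  fixes \<Omega> :: "(real^'n::finite) set"
  assumes "open \<Omega>" "z \<in> L2 \<Omega>"
    and orth: "\<And>\<phi>. \<phi> \<in> test_functions \<Omega> \<Longrightarrow> L2_inner \<Omega> z \<phi> = 0"
  shows "AE x in lebesgue_on \<Omega>. z x = 0"
proof -
  let ?M = "lebesgue_on \<Omega>"
  have open_zero: "integrable ?M (\<lambda>x. indicator V x * cnj (z x))"
      "(LINT x|?M. indicator V x * cnj (z x)) = 0" if "open V" "bounded V" "V \<subseteq> \<Omega>" for V
    using orthogonal_imp_integral_open_zero[OF assms(1,2) orth that] by auto
  have "AE x in ?M. indicator (\<Omega> \<inter> ball 0 (real R)) x * cnj (z x) = 0" for R
  proof -
    define U where "U = \<Omega> \<inter> ball 0 (real R)"
    define h where "h x = indicator U x * cnj (z x)" for x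
    have U: "open U" "bounded U" "U \<subseteq> \<Omega>"
      using \<open>open \<Omega>\<close> by (auto simp: U_def bounded_Int)
    have h: "integrable ?M h"
      unfolding h_def by (rule open_zero(1)[OF U])
    then have [measurable]: "h \<in> borel_measurable ?M" by simp
    have "AE x in ?M. h x = 0"
    proof (rule sigma_finite_measure.density_zero[OF sigma_finite_lebesgue_on h])
      show "\<Omega> \<in> sets lebesgue"
        using \<open>open \<Omega>\<close> by simp
    next
      fix A assume A: "A \<in> sets ?M"
      then have "A \<in> sets lebesgue"
        using \<open>open \<Omega>\<close> by (simp add: sets_restrict_space_iff)
      have "\<exists>T. open T \<and> A \<subseteq> T \<and> T - A \<in> lmeasurable \<and> emeasure lebesgue (T - A) < ennreal (1 / Suc m)" for m
      proof -
        have "0 < 1 / real (Suc m)" by simp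
        then obtain T where "open T" "A \<subseteq> T" "T - A \<in> lmeasurable"
          "emeasure lebesgue (T - A) < ennreal (1 / Suc m)"
          by (rule sets_lebesgue_outer_open[OF \<open>A \<in> sets lebesgue\<close>])
        then show ?thesis by (intro exI[of _ T] conjI)
      qed
      then obtain T where T: "\<And>m. open (T m)" "\<And>m. A \<subseteq> T m" "\<And>m. T m - A \<in> lmeasurable"
        "\<And>m. emeasure lebesgue (T m - A) < ennreal (1 / Suc m)"
        by metis
      define N where "N = (\<Inter>m. T m) - A"
      have N_sets: "N \<in> sets lebesgue"
        unfolding N_def using T(1) \<open>A \<in> sets lebesgue\<close> by auto
      have "emeasure lebesgue N \<le> ennreal (1 / Suc m)" for m
      proof -
        have "emeasure lebesgue N \<le> emeasure lebesgue (T m - A)"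
          using T(3) by (intro emeasure_mono) (auto simp: N_def dest: fmeasurableD)
        with T(4)[of m] show ?thesis by simp
      qed
      moreover have "(\<lambda>m. ennreal (1 / Suc m)) \<longlonglongrightarrow> ennreal 0"
        using LIMSEQ_inverse_real_of_nat by (intro tendsto_ennrealI) (simp add: inverse_eq_divide)
      ultimately have "emeasure lebesgue N \<le> 0"
        using LIMSEQ_le_const[of "\<lambda>m. ennreal (1 / Suc m)" "ennreal 0" "emeasure lebesgue N"] by auto
      then have "AE x in lebesgue. x \<notin> N"
        using N_sets by (intro AE_not_in null_setsI) auto
      then have notN: "AE x in ?M. x \<notin> N"
        using \<open>open \<Omega>\<close> by (subst AE_restrict_space_iff) (auto elim: eventually_mono)
      define S where "S m = U \<inter> (\<Inter>i\<le>m. T i)" for m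
      have S: "open (S m)" "bounded (S m)" "S m \<subseteq> \<Omega>" "S m \<subseteq> U" for m
        using U T(1) by (auto simp: S_def bounded_Int intro!: open_Int open_INT)
      have [measurable]: "S m \<in> sets ?M" for m
        using S[of m] \<open>open \<Omega>\<close> by (simp add: sets_restrict_space_iff)
      have "(\<lambda>m. LINT x|?M. indicator (S m) x *\<^sub>R h x) \<longlonglongrightarrow> (LINT x|?M. indicator A x *\<^sub>R h x)"
      proof (rule integral_dominated_convergence)
        show "integrable ?M (\<lambda>x. norm (h x))"
          using h by simp
        show "AE x in ?M. (\<lambda>m. indicator (S m) x *\<^sub>R h x) \<longlonglongrightarrow> indicator A x *\<^sub>R h x"
          using notN
        proof eventually_elim
          case (elim x)
          consider "x \<in> A" | i where "x \<notin> T i" "x \<notin> A"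
            using elim by (auto simp: N_def)
          then show ?case
          proof cases
            case 1
            then have "indicator (S m) x *\<^sub>R h x = h x" for m
              using T(2) by (auto simp: S_def h_def indicator_def)
            with 1 show ?thesis by simp
          next
            case 2
            have "indicator (S m) x *\<^sub>R h x = 0" if "m \<ge> i" for m
              using 2 that by (auto simp: S_def indicator_def)
            then have "\<forall>\<^sub>F m in sequentially. indicator (S m) x *\<^sub>R h x = 0"
              by (rule eventually_sequentiallyI)
            with 2 show ?thesis by (simp add: tendsto_eventually)
          qed
        qed
        show "AE x in ?M. norm (indicator (S m) x *\<^sub>R h x) \<le> norm (h x)" for m
          by (simp add: indicator_def)
      qed (use A in measurable)
      moreover have "(LINT x|?M. indicator (S m) x *\<^sub>R h x) = 0" for m
      proof -
        have "(LINT x|?M. indicator (S m) x *\<^sub>R h x) = (LINT x|?M. indicator (S m) x * cnj (z x))"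
          using S(4)[of m] by (intro Bochner_Integration.integral_cong) (auto simp: h_def indicator_def)
        then show ?thesis using open_zero(2)[OF S(1-3)] by simp
      qed
      ultimately show "set_lebesgue_integral ?M A h = 0"
        by (simp add: LIMSEQ_const_iff set_lebesgue_integral_def)
    qed
    then show ?thesis by (simp add: h_def U_def)
  qed
  then have "AE x in ?M. \<forall>R. indicator (\<Omega> \<inter> ball 0 (real R)) x * cnj (z x) = 0"
    unfolding AE_all_countable by blast
  moreover have "AE x in ?M. x \<in> \<Omega>"
    using AE_space[of ?M] by simp
  ultimately show ?thesis
  proof eventually_elim
    case (elim x)
    obtain R :: nat where "norm x < real R"
      using reals_Archimedean2 by blast
    with elim show ?case by (auto dest: spec[of _ R])
  qed
qed

section \<open>Integration by parts\<close>

text \<open>Every difference quotient of \<open>F\<close> has integral \<open>0\<close>, because Lebesgue measure is invariant under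
  translations. By the mean value inequality the quotients with steps in \<open>(0, 1]\<close> are bounded by the
  maximum of the derivative, and they vanish outside of a common ball, so dominated
  convergence applies as the step tends to \<open>0\<close>.\<close>

lemma integral_classical_partial_zero:
  fixes F :: "real^'n::finite \<Rightarrow> complex"
  assumes diff: "\<And>x. F differentiable (at x)"
    and cont: "continuous_on UNIV (classical_partial k F)"
    and K: "compact K" "\<And>x. x \<notin> K \<Longrightarrow> F x = 0" "\<And>x. x \<notin> K \<Longrightarrow> classical_partial k F x = 0"
  shows "integral\<^sup>L lborel (classical_partial k F) = 0"
proof -
  let ?g = "classical_partial k F" and ?e = "axis k 1 :: real^'n"
  define h where "h m = inverse (real (Suc m))" for m
  have h: "0 < h m" "h m \<le> 1" for m
    by (auto simp: h_def field_simps)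
  have h_lim: "h \<longlonglongrightarrow> 0"
    unfolding h_def by (rule LIMSEQ_inverse_real_of_nat)
  have cont_F: "continuous_on UNIV F"
    using diff by (simp add: continuous_at_imp_continuous_on differentiable_imp_continuous_within)
  have int_F: "integrable lborel F"
    using cont_F K by (intro continuous_compact_support_integrable)
  define Q where "Q m x = (F (h m *\<^sub>R ?e + x) - F x) /\<^sub>R h m" for m x
  obtain B where B: "B \<ge> 0" "\<And>x. cmod (?g x) \<le> B"
  proof -
    have "compact (?g ` K)"
      using cont K(1) by (intro compact_continuous_image) (auto intro: continuous_on_subset)
    then have "bounded (?g ` K)"
      by (rule compact_imp_bounded)
    then obtain b where "\<And>x. x \<in> K \<Longrightarrow> cmod (?g x) \<le> b"
      unfolding bounded_iff by blast
    then have "cmod (?g x) \<le> max 0 b" for x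
      using K(3)[of x] by (cases "x \<in> K") (auto simp: le_max_iff_disj)
    then show thesis by (intro that[of "max 0 b"]) auto
  qed
  obtain R where R: "\<And>x. x \<in> K \<Longrightarrow> norm x \<le> R"
    using compact_imp_bounded[OF K(1)] unfolding bounded_iff by blast
  have Q_bound: "norm (Q m x) \<le> B * indicator (cball 0 (R + 1)) x" for m x
  proof (cases "x \<in> cball 0 (R + 1)")
    case True
    have "norm (F (x + h m *\<^sub>R ?e) - F (x + 0 *\<^sub>R ?e)) \<le> B * norm (h m - 0)"
    proof (rule differentiable_bound[where S = UNIV and f' = "\<lambda>t s. s *\<^sub>R ?g (x + t *\<^sub>R ?e)"])
      fix t :: real
      have "((\<lambda>t. x + t *\<^sub>R ?e) has_derivative (\<lambda>s. s *\<^sub>R ?e)) (at t)"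
        by (auto intro!: derivative_eq_intros)
      from has_derivative_compose[OF this diff[unfolded frechet_derivative_works]]
      have "((\<lambda>t. F (x + t *\<^sub>R ?e)) has_derivative
          (\<lambda>s. frechet_derivative F (at (x + t *\<^sub>R ?e)) (s *\<^sub>R ?e))) (at t)" .
      also have "(\<lambda>s. frechet_derivative F (at (x + t *\<^sub>R ?e)) (s *\<^sub>R ?e))
          = (\<lambda>s. s *\<^sub>R ?g (x + t *\<^sub>R ?e))"
        using linear_frechet_derivative[OF diff]
        by (simp add: classical_partial_def linear_cmul)
      finally show "((\<lambda>t. F (x + t *\<^sub>R ?e)) has_derivative (\<lambda>s. s *\<^sub>R ?g (x + t *\<^sub>R ?e))) (at t within UNIV)" .
      show "onorm (\<lambda>s. s *\<^sub>R ?g (x + t *\<^sub>R ?e)) \<le> B"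
        using B by (intro onorm_bound) (auto simp: mult.commute[of B] intro: mult_left_mono)
    qed auto
    then show ?thesis
      using True h[of m]
      by (simp add: Q_def add.commute inverse_eq_divide pos_divide_le_eq)
  next
    case False
    then have "norm x > R + 1" by simp
    moreover have "norm (h m *\<^sub>R ?e) \<le> 1"
      using h[of m] by simp
    ultimately have "norm (h m *\<^sub>R ?e + x) > R" "norm x > R"
      using norm_triangle_ineq2[of x "- (h m *\<^sub>R ?e)"] by (auto simp: add.commute)
    then have "x \<notin> K" "h m *\<^sub>R ?e + x \<notin> K"
      using R by force+
    with False show ?thesis by (simp add: Q_def K(2))
  qed
  have Q_lim: "(\<lambda>m. Q m x) \<longlonglongrightarrow> ?g x" for x
  proof -
    have "(\<lambda>y. norm (F (x + y) - F x - frechet_derivative F (at x) y) / norm y) \<midarrow>0\<rightarrow> 0"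
      using diff[of x] by (simp add: frechet_derivative_works has_derivative_at)
    moreover have "filterlim (\<lambda>m. h m *\<^sub>R ?e) (at 0) sequentially"
      using h tendsto_scaleR[OF h_lim tendsto_const[of ?e]]
      by (intro filterlim_atI) (auto simp: less_imp_neq[symmetric] intro!: always_eventually)
    ultimately have "(\<lambda>m. norm (F (x + h m *\<^sub>R ?e) - F x - frechet_derivative F (at x) (h m *\<^sub>R ?e))
        / norm (h m *\<^sub>R ?e)) \<longlonglongrightarrow> 0"
      by (rule filterlim_compose)
    also have "(\<lambda>m. norm (F (x + h m *\<^sub>R ?e) - F x - frechet_derivative F (at x) (h m *\<^sub>R ?e))
        / norm (h m *\<^sub>R ?e)) = (\<lambda>m. norm (Q m x - ?g x))"
    proof
      fix m
      have "F (x + h m *\<^sub>R ?e) - F x - frechet_derivative F (at x) (h m *\<^sub>R ?e)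
          = h m *\<^sub>R (Q m x - ?g x)"
        using h[of m] linear_frechet_derivative[OF diff]
        by (simp add: Q_def classical_partial_def linear_cmul add.commute scaleR_right_diff_distrib)
      then show "norm (F (x + h m *\<^sub>R ?e) - F x - frechet_derivative F (at x) (h m *\<^sub>R ?e))
        / norm (h m *\<^sub>R ?e) = norm (Q m x - ?g x)"
        using h[of m] by simp
    qed
    finally show ?thesis
      by (simp add: tendsto_norm_zero_iff LIM_zero_iff)
  qed
  have [measurable]: "F \<in> borel_measurable borel"
    using cont_F by (rule borel_measurable_continuous_onI)
  have shift: "integrable lborel (\<lambda>x. F (a + x)) \<and> (LINT x|lborel. F (a + x)) = (LINT x|lborel. F x)" for a
    using int_F integrable_distr_eq[of "(+) a" lborel borel F]
      integral_distr[of "(+) a" lborel borel F] by (simp add: lborel_distr_plus)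
  have "integral\<^sup>L lborel (Q m) = 0" for m
    using shift[of "h m *\<^sub>R ?e"] int_F by (simp add: Q_def[abs_def])
  moreover have "(\<lambda>m. integral\<^sup>L lborel (Q m)) \<longlonglongrightarrow> integral\<^sup>L lborel ?g"
  proof (rule integral_dominated_convergence)
    show "?g \<in> borel_measurable lborel"
      using borel_measurable_continuous_onI[OF cont] by simp
    show "Q m \<in> borel_measurable lborel" for m
      unfolding Q_def[abs_def] by measurable
    show "integrable lborel (\<lambda>x. B * indicator (cball 0 (R + 1)) x)"
      using emeasure_bounded_finite[OF bounded_cball]
      by (intro integrable_mult_right integrable_real_indicator) auto
    show "AE x in lborel. (\<lambda>m. Q m x) \<longlonglongrightarrow> ?g x"
      using Q_lim by simp
    show "AE x in lborel. norm (Q m x) \<le> B * indicator (cball 0 (R + 1)) x" for m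
      using Q_bound by simp
  qed
  ultimately show ?thesis by (simp add: LIMSEQ_const_iff)
qed

lemma integration_by_parts:
  fixes \<Omega> :: "(real^'n::finite) set"
  assumes "open \<Omega>" "\<phi> \<in> test_functions \<Omega>" "\<psi> \<in> test_functions \<Omega>"
  shows "L2_inner \<Omega> \<phi> (classical_partial k \<psi>) = - L2_inner \<Omega> (classical_partial k \<phi>) \<psi>"
proof -
  let ?F = "\<lambda>x. cnj (\<phi> x) * \<psi> x"
  have sm: "smooth \<phi>" "smooth \<psi>"
    using assms by (auto intro: test_functions_smooth)
  have diff: "(\<lambda>x. cnj (\<phi> x)) differentiable (at x)" "\<psi> differentiable (at x)" "\<phi> differentiable (at x)" for x
    using sm smooth_differentiable[of \<phi> x] bounded_linear_imp_differentiable[OF bounded_linear_cnj]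
      differentiable_chain_at[of \<phi> x cnj]
    by (auto intro: smooth_differentiable simp: o_def)
  have F': "classical_partial k ?F = (\<lambda>x. cnj (\<phi> x) * classical_partial k \<psi> x + cnj (classical_partial k \<phi> x) * \<psi> x)"
    using diff by (simp add: fun_eq_iff classical_partial_mult classical_partial_cnj)
  obtain K where K: "compact K" "K \<subseteq> \<Omega>" "\<And>x. x \<notin> K \<Longrightarrow> \<phi> x = 0"
    "\<And>k x. x \<notin> K \<Longrightarrow> classical_partial k \<phi> x = 0"
    using test_functions_support[OF assms(2)] by metis
  have cont: "continuous_on UNIV (classical_partial k ?F)"
    unfolding F' using sm
    by (intro continuous_intros) (auto intro: smooth_continuous smooth_classical_partial)
  have "L2_inner \<Omega> \<phi> (classical_partial k \<psi>) + L2_inner \<Omega> (classical_partial k \<phi>) \<psi>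
      = integral\<^sup>L (lebesgue_on \<Omega>) (classical_partial k ?F)"
    using assms
    by (simp add: L2_inner_def F' L2_mult_integrable test_functions_L2 test_functions_partial_L2)
  also have "\<dots> = integral\<^sup>L lborel (classical_partial k ?F)"
    using assms(1) K cont
    by (intro integral_lebesgue_on_supported borel_measurable_continuous_onI)
      (use K(2,3,4) in \<open>auto simp: F' dest: contra_subsetD\<close>)
  also have "\<dots> = 0"
    using diff K by (intro integral_classical_partial_zero[OF _ cont K(1)]) (auto simp: F' K)
  finally show ?thesis by (simp add: eq_neg_iff_add_eq_0)
qed

section \<open>Weak partial derivatives\<close>

text \<open>The weak partial derivative as a relation: it permits linear combinations and limits to be
  formed without fixing representatives.\<close>

definition has_weak_partial :: "(real^'n::finite) set \<Rightarrow> 'n \<Rightarrow> 'n cfun \<Rightarrow> 'n cfun \<Rightarrow> bool" where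
  "has_weak_partial \<Omega> k f g \<longleftrightarrow> f \<in> L2 \<Omega> \<and> g \<in> L2 \<Omega> \<and>
    (\<forall>\<phi>\<in>test_functions \<Omega>. L2_inner \<Omega> f (classical_partial k \<phi>) = - L2_inner \<Omega> g \<phi>)"

lemma has_weak_partial_iff_adj: "has_weak_partial \<Omega> k f g \<longleftrightarrow> (f, - g) \<in> weak_partial_adj \<Omega> k"
proof -
  have "g \<in> L2 \<Omega> \<longleftrightarrow> - g \<in> L2 \<Omega>"
    using L2_uminus[of g] L2_uminus[of "- g"] by (auto simp: fun_Compl_def)
  then show ?thesis
    by (auto simp: has_weak_partial_def weak_partial_adj_def adj_graph_def L2_inner_uminus_left)
qed

lemma has_weak_partial_weak_partial:
  assumes "f \<in> weak_partial_dom \<Omega> k"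
  shows "has_weak_partial \<Omega> k f (weak_partial \<Omega> k f)"
proof -
  have "\<exists>g. (f, g) \<in> weak_partial_adj \<Omega> k"
    using assms by (auto simp: weak_partial_dom_def)
  then have "(f, SOME g. (f, g) \<in> weak_partial_adj \<Omega> k) \<in> weak_partial_adj \<Omega> k"
    by (rule someI_ex)
  then show ?thesis
    by (simp add: has_weak_partial_iff_adj weak_partial_def fun_Compl_def)
qed

lemma has_weak_partial_dom: "has_weak_partial \<Omega> k f g \<Longrightarrow> f \<in> weak_partial_dom \<Omega> k"
  by (auto simp: has_weak_partial_iff_adj weak_partial_dom_def)

lemma L2_eq_AE_if_inner_eq:
  assumes "open \<Omega>" "f \<in> L2 \<Omega>" "g \<in> L2 \<Omega>"
    and "\<And>\<phi>. \<phi> \<in> test_functions \<Omega> \<Longrightarrow> L2_inner \<Omega> f \<phi> = L2_inner \<Omega> g \<phi>"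
  shows "AE x in lebesgue_on \<Omega>. f x = g x"
proof -
  have "AE x in lebesgue_on \<Omega>. (f - g) x = 0"
    using assms
    by (intro L2_orthogonal_to_test_functions[of \<Omega> "f - g"] L2_diff)
      (simp_all add: L2_inner_diff_left test_functions_L2)
  then show ?thesis by simp
qed

lemma has_weak_partial_unique:
  assumes "open \<Omega>" "has_weak_partial \<Omega> k f g" "has_weak_partial \<Omega> k f h"
  shows "AE x in lebesgue_on \<Omega>. g x = h x"
  using assms by (intro L2_eq_AE_if_inner_eq) (auto simp: has_weak_partial_def)

lemma weak_partial_AE:
  assumes "open \<Omega>" "has_weak_partial \<Omega> k f g"
  shows "AE x in lebesgue_on \<Omega>. weak_partial \<Omega> k f x = g x"
  using has_weak_partial_unique[OF assms(1) has_weak_partial_weak_partial[OF has_weak_partial_dom]]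
    assms(2) by blast

lemma L2_norm_weak_partial:
  assumes "open \<Omega>" "has_weak_partial \<Omega> k f g"
  shows "L2_norm \<Omega> (weak_partial \<Omega> k f) = L2_norm \<Omega> g"
proof -
  have "weak_partial \<Omega> k f \<in> L2 \<Omega>" "g \<in> L2 \<Omega>"
    using assms(2) has_weak_partial_weak_partial[OF has_weak_partial_dom[OF assms(2)]]
    by (auto simp: has_weak_partial_def)
  then show ?thesis
    using weak_partial_AE[OF assms] by (intro L2_norm_cong_AE L2_measurable)
qed

lemma has_weak_partial_diff:
  assumes "open \<Omega>" "has_weak_partial \<Omega> k f g" "has_weak_partial \<Omega> k f' g'"
  shows "has_weak_partial \<Omega> k (f - f') (g - g')"
  using assms
  by (simp add: has_weak_partial_def L2_diff L2_inner_diff_left test_functions_L2 test_functions_partial_L2)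

lemma test_functions_has_weak_partial:
  assumes "open \<Omega>" "\<phi> \<in> test_functions \<Omega>"
  shows "has_weak_partial \<Omega> k \<phi> (classical_partial k \<phi>)"
  using assms integration_by_parts[OF assms]
  by (simp add: has_weak_partial_def test_functions_L2 test_functions_partial_L2)

text \<open>The graph of the weak derivative is closed, since both sides of its defining identity are
  continuous in norm.\<close>

lemma has_weak_partial_limit:
  assumes "open \<Omega>"
    and hwp: "\<And>m. has_weak_partial \<Omega> k (f m) (g m)"
    and L2: "u \<in> L2 \<Omega>" "v \<in> L2 \<Omega>"
    and lim: "(\<lambda>m. L2_norm \<Omega> (f m - u)) \<longlonglongrightarrow> 0" "(\<lambda>m. L2_norm \<Omega> (g m - v)) \<longlonglongrightarrow> 0"
  shows "has_weak_partial \<Omega> k u v"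
  unfolding has_weak_partial_def
proof (intro conjI ballI L2)
  fix \<phi> assume \<phi>: "\<phi> \<in> test_functions \<Omega>"
  have fg: "f m \<in> L2 \<Omega>" "g m \<in> L2 \<Omega>"
    "L2_inner \<Omega> (f m) (classical_partial k \<phi>) = - L2_inner \<Omega> (g m) \<phi>" for m
    using hwp[of m] \<phi> by (auto simp: has_weak_partial_def)
  have "(\<lambda>m. L2_inner \<Omega> (f m) (classical_partial k \<phi>)) \<longlonglongrightarrow> L2_inner \<Omega> u (classical_partial k \<phi>)"
    by (intro L2_inner_tendsto_left fg L2 lim test_functions_partial_L2 \<open>open \<Omega>\<close> \<phi>)
  moreover have "(\<lambda>m. - L2_inner \<Omega> (g m) \<phi>) \<longlonglongrightarrow> - L2_inner \<Omega> v \<phi>"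
    by (intro tendsto_minus L2_inner_tendsto_left fg L2 lim test_functions_L2 \<open>open \<Omega>\<close> \<phi>)
  ultimately show "L2_inner \<Omega> u (classical_partial k \<phi>) = - L2_inner \<Omega> v \<phi>"
    unfolding fg(3) by (rule LIMSEQ_unique)
qed

section \<open>The space of functions vanishing on the boundary\<close>

lemma W1_has_weak_partial: "f \<in> W1 \<Omega> \<Longrightarrow> has_weak_partial \<Omega> k f (weak_partial \<Omega> k f)"
  by (intro has_weak_partial_weak_partial) (simp add: W1_def)

lemma L2_norm_le_W1_norm: "L2_norm \<Omega> f \<le> W1_norm \<Omega> f"
  unfolding W1_norm_def by (rule real_le_rsqrt) (simp add: sum_nonneg)

lemma L2_norm_weak_partial_le_W1_norm: "L2_norm \<Omega> (weak_partial \<Omega> k f) \<le> W1_norm \<Omega> f"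
  unfolding W1_norm_def
proof (rule real_le_rsqrt)
  have "(L2_norm \<Omega> (weak_partial \<Omega> k f))\<^sup>2 \<le> (\<Sum>k\<in>UNIV. (L2_norm \<Omega> (weak_partial \<Omega> k f))\<^sup>2)"
    by (intro member_le_sum) auto
  then show "(L2_norm \<Omega> (weak_partial \<Omega> k f))\<^sup>2
      \<le> (L2_norm \<Omega> f)\<^sup>2 + (\<Sum>k\<in>UNIV. (L2_norm \<Omega> (weak_partial \<Omega> k f))\<^sup>2)"
    by (simp add: add_increasing)
qed

lemma W10_I:
  assumes "open \<Omega>"
    and hwp: "\<And>k. has_weak_partial \<Omega> k u (v k)"
    and test: "\<And>m. \<phi> m \<in> test_functions \<Omega>"
    and lim: "(\<lambda>m. L2_norm \<Omega> (\<phi> m - u)) \<longlonglongrightarrow> 0"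
      "\<And>k. (\<lambda>m. L2_norm \<Omega> (classical_partial k (\<phi> m) - v k)) \<longlonglongrightarrow> 0"
  shows "u \<in> W10 \<Omega>"
proof -
  have "u \<in> W1 \<Omega>"
    using has_weak_partial_dom[OF hwp] by (simp add: W1_def)
  moreover have "\<exists>\<phi>\<in>test_functions \<Omega>. W1_norm \<Omega> (u - \<phi>) < e" if "e > 0" for e
  proof -
    have "W1_norm \<Omega> (u - \<phi> m) = sqrt ((L2_norm \<Omega> (\<phi> m - u))\<^sup>2
        + (\<Sum>k\<in>UNIV. (L2_norm \<Omega> (classical_partial k (\<phi> m) - v k))\<^sup>2))" for m
      using L2_norm_weak_partial[OF \<open>open \<Omega>\<close> has_weak_partial_diff[OF \<open>open \<Omega>\<close> hwp
          test_functions_has_weak_partial[OF \<open>open \<Omega>\<close> test]], of _ m]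
      by (simp add: W1_norm_def L2_norm_minus_commute)
    moreover have "(\<lambda>m. sqrt ((L2_norm \<Omega> (\<phi> m - u))\<^sup>2
        + (\<Sum>k\<in>UNIV. (L2_norm \<Omega> (classical_partial k (\<phi> m) - v k))\<^sup>2))) \<longlonglongrightarrow> sqrt (0\<^sup>2 + (\<Sum>k\<in>(UNIV::'a set). 0\<^sup>2))"
      by (intro tendsto_intros lim)
    ultimately have "(\<lambda>m. W1_norm \<Omega> (u - \<phi> m)) \<longlonglongrightarrow> 0" by simp
    then have "\<forall>\<^sub>F m in sequentially. W1_norm \<Omega> (u - \<phi> m) < e"
      using \<open>e > 0\<close> by (rule order_tendstoD)
    then show ?thesis
      using test by (auto simp: eventually_sequentially)
  qed
  ultimately show ?thesis by (simp add: W10_def)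
qed

text \<open>One sequence serves the function and all of its partial derivatives, because every one of these
  norms is at most the norm of \<open>W\<^sup>1\<close>.\<close>

lemma W10_approximation:
  assumes "open \<Omega>" "u \<in> W10 \<Omega>"
  obtains \<phi> where "\<And>m::nat. \<phi> m \<in> test_functions \<Omega>"
    and "(\<lambda>m. L2_norm \<Omega> (\<phi> m - u)) \<longlonglongrightarrow> 0"
    and "\<And>k. (\<lambda>m. L2_norm \<Omega> (classical_partial k (\<phi> m) - weak_partial \<Omega> k u)) \<longlonglongrightarrow> 0"
proof -
  have "\<forall>m::nat. \<exists>\<phi>\<in>test_functions \<Omega>. W1_norm \<Omega> (u - \<phi>) < inverse (real (Suc m))"
    using assms(2) by (auto simp: W10_def)
  then obtain \<phi> where \<phi>: "\<And>m::nat. \<phi> m \<in> test_functions \<Omega>"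
    and le: "\<And>m. W1_norm \<Omega> (u - \<phi> m) < inverse (real (Suc m))"
    by metis
  show thesis
  proof (rule that[OF \<phi>])
    show "(\<lambda>m. L2_norm \<Omega> (\<phi> m - u)) \<longlonglongrightarrow> 0"
    proof (rule Lim_null_comparison[OF always_eventually LIMSEQ_inverse_real_of_nat], rule allI)
      show "norm (L2_norm \<Omega> (\<phi> m - u)) \<le> inverse (real (Suc m))" for m
        using order_trans[OF L2_norm_le_W1_norm less_imp_le[OF le]]
        by (simp add: L2_norm_nonneg L2_norm_minus_commute[of _ _ u])
    qed
    fix k
    have "L2_norm \<Omega> (classical_partial k (\<phi> m) - weak_partial \<Omega> k u) \<le> W1_norm \<Omega> (u - \<phi> m)" for m
    proof -
      have "has_weak_partial \<Omega> k (u - \<phi> m) (weak_partial \<Omega> k u - classical_partial k (\<phi> m))"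
        using assms \<phi>
        by (intro has_weak_partial_diff W1_has_weak_partial test_functions_has_weak_partial)
          (auto simp: W10_def)
      from L2_norm_weak_partial[OF \<open>open \<Omega>\<close> this] show ?thesis
        using L2_norm_weak_partial_le_W1_norm[of \<Omega> k "u - \<phi> m"]
        by (simp add: L2_norm_minus_commute)
    qed
    then show "(\<lambda>m. L2_norm \<Omega> (classical_partial k (\<phi> m) - weak_partial \<Omega> k u)) \<longlonglongrightarrow> 0"
      by (intro Lim_null_comparison[OF always_eventually LIMSEQ_inverse_real_of_nat] allI)
        (use order_trans[OF _ less_imp_le[OF le]] in \<open>simp add: L2_norm_nonneg\<close>)
  qed
qed

lemma test_functions_W10:
  assumes "open \<Omega>" "\<phi> \<in> test_functions \<Omega>"
  shows "\<phi> \<in> W10 \<Omega>"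
  using assms
  by (intro W10_I[where v = "\<lambda>k. classical_partial k \<phi>" and \<phi> = "\<lambda>_. \<phi>"]
      test_functions_has_weak_partial) (simp_all add: L2_norm_def)

lemma W10_diff:
  assumes "open \<Omega>" "u \<in> W10 \<Omega>" "w \<in> W10 \<Omega>"
  shows "u - w \<in> W10 \<Omega>"
proof -
  obtain \<phi> where \<phi>: "\<And>m. \<phi> m \<in> test_functions \<Omega>" "(\<lambda>m. L2_norm \<Omega> (\<phi> m - u)) \<longlonglongrightarrow> 0"
    "\<And>k. (\<lambda>m. L2_norm \<Omega> (classical_partial k (\<phi> m) - weak_partial \<Omega> k u)) \<longlonglongrightarrow> 0"
    using W10_approximation[OF assms(1,2)] by metis
  obtain \<psi> where \<psi>: "\<And>m. \<psi> m \<in> test_functions \<Omega>" "(\<lambda>m. L2_norm \<Omega> (\<psi> m - w)) \<longlonglongrightarrow> 0"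
    "\<And>k. (\<lambda>m. L2_norm \<Omega> (classical_partial k (\<psi> m) - weak_partial \<Omega> k w)) \<longlonglongrightarrow> 0"
    using W10_approximation[OF assms(1,3)] by metis
  have hwp: "has_weak_partial \<Omega> k u (weak_partial \<Omega> k u)" "has_weak_partial \<Omega> k w (weak_partial \<Omega> k w)" for k
    using assms by (auto intro: W1_has_weak_partial simp: W10_def)
  have L2: "u \<in> L2 \<Omega>" "w \<in> L2 \<Omega>" "weak_partial \<Omega> k u \<in> L2 \<Omega>" "weak_partial \<Omega> k w \<in> L2 \<Omega>" for k
    using hwp by (auto simp: has_weak_partial_def)
  have diff_lim: "(\<lambda>m. L2_norm \<Omega> (a m - b m - (f - g))) \<longlonglongrightarrow> 0"
    if "\<And>m. a m \<in> L2 \<Omega>" "\<And>m. b m \<in> L2 \<Omega>" "f \<in> L2 \<Omega>" "g \<in> L2 \<Omega>"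
      "(\<lambda>m. L2_norm \<Omega> (a m - f)) \<longlonglongrightarrow> 0" "(\<lambda>m. L2_norm \<Omega> (b m - g)) \<longlonglongrightarrow> 0" for a b f g
  proof (rule Lim_null_comparison)
    have eq: "a m - b m - (f - g) = a m - f - (b m - g)" for m
      by (simp add: fun_eq_iff)
    show "\<forall>\<^sub>F m in sequentially. norm (L2_norm \<Omega> (a m - b m - (f - g)))
        \<le> L2_norm \<Omega> (a m - f) + L2_norm \<Omega> (b m - g)"
      unfolding eq using that by (simp add: L2_norm_nonneg L2_norm_diff_triangle L2_diff)
    show "(\<lambda>m. L2_norm \<Omega> (a m - f) + L2_norm \<Omega> (b m - g)) \<longlonglongrightarrow> 0"
      using tendsto_add[OF that(5,6)] by simp
  qed
  show ?thesis
  proof (rule W10_I[OF \<open>open \<Omega>\<close>])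
    show "has_weak_partial \<Omega> k (u - w) (weak_partial \<Omega> k u - weak_partial \<Omega> k w)" for k
      by (intro has_weak_partial_diff hwp \<open>open \<Omega>\<close>)
    show "\<phi> m - \<psi> m \<in> test_functions \<Omega>" for m
      by (intro test_functions_diff \<phi> \<psi>)
    show "(\<lambda>m. L2_norm \<Omega> (\<phi> m - \<psi> m - (u - w))) \<longlonglongrightarrow> 0"
      by (intro diff_lim \<phi>(2) \<psi>(2) L2 test_functions_L2 \<open>open \<Omega>\<close> \<phi>(1) \<psi>(1))
    show "(\<lambda>m. L2_norm \<Omega> (classical_partial k (\<phi> m - \<psi> m)
        - (weak_partial \<Omega> k u - weak_partial \<Omega> k w))) \<longlonglongrightarrow> 0" for k
      unfolding test_functions_classical_partial_diff[OF \<phi>(1) \<psi>(1)]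
      by (intro diff_lim \<phi>(3) \<psi>(3) L2 test_functions_partial_L2 \<open>open \<Omega>\<close> \<phi>(1) \<psi>(1))
  qed
qed

definition poincare :: "(real^'n::finite) set \<Rightarrow> 'n \<Rightarrow> real \<Rightarrow> bool" where
  "poincare \<Omega> j c \<longleftrightarrow> 0 < c \<and> (\<forall>f\<in>W10 \<Omega>. c * L2_norm \<Omega> f \<le> L2_norm \<Omega> (weak_partial \<Omega> j f))"

lemma poincare_test_function:
  assumes "open \<Omega>" "poincare \<Omega> j c" "\<phi> \<in> test_functions \<Omega>"
  shows "L2_norm \<Omega> \<phi> \<le> L2_norm \<Omega> (classical_partial j \<phi>) / c"
proof -
  have "c * L2_norm \<Omega> \<phi> \<le> L2_norm \<Omega> (weak_partial \<Omega> j \<phi>)"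
    using assms(2) test_functions_W10[OF assms(1,3)] by (auto simp: poincare_def)
  also have "\<dots> = L2_norm \<Omega> (classical_partial j \<phi>)"
    by (intro L2_norm_weak_partial test_functions_has_weak_partial assms)
  finally show ?thesis
    using assms(2) by (simp add: poincare_def pos_le_divide_eq mult.commute)
qed

section \<open>The adjoint of the gradient\<close>

lemma nabla0_adj_graph_iff:
  "(q, g) \<in> nabla0_adj_graph \<Omega> \<longleftrightarrow> q \<in> L2n \<Omega> \<and> g \<in> L2 \<Omega> \<and>
    (\<forall>\<phi>\<in>test_functions \<Omega>. (\<Sum>k\<in>UNIV. L2_inner \<Omega> (q $ k) (classical_partial k \<phi>)) = L2_inner \<Omega> g \<phi>)"
  by (simp add: nabla0_adj_graph_def adj_graph_def L2n_inner_def nabla0_def)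

lemma nabla0_adj_graph_nabla0_adj:
  "q \<in> nabla0_adj_dom \<Omega> \<Longrightarrow> (q, nabla0_adj \<Omega> q) \<in> nabla0_adj_graph \<Omega>"
  using someI_ex[of "\<lambda>g. (q, g) \<in> nabla0_adj_graph \<Omega>"]
  by (auto simp: nabla0_adj_dom_def nabla0_adj_def)

lemma nabla0_adj_AE:
  assumes "open \<Omega>" "(q, g) \<in> nabla0_adj_graph \<Omega>"
  shows "AE x in lebesgue_on \<Omega>. nabla0_adj \<Omega> q x = g x"
proof -
  have "q \<in> nabla0_adj_dom \<Omega>"
    using assms(2) by (auto simp: nabla0_adj_dom_def)
  from nabla0_adj_graph_nabla0_adj[OF this] assms show ?thesis
    by (intro L2_eq_AE_if_inner_eq) (auto simp: nabla0_adj_graph_iff)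
qed

text \<open>The identity that defines the adjoint concerns test functions; both of its sides are continuous in
  the norm of \<open>W\<^sup>1\<close>, so it extends to their closure.\<close>

lemma nabla0_adj_inner_W10:
  assumes "open \<Omega>" "(q, g) \<in> nabla0_adj_graph \<Omega>" "u \<in> W10 \<Omega>"
  shows "L2n_inner \<Omega> q (nabla_w \<Omega> u) = L2_inner \<Omega> g u"
proof -
  obtain \<phi> where \<phi>: "\<And>m. \<phi> m \<in> test_functions \<Omega>" "(\<lambda>m. L2_norm \<Omega> (\<phi> m - u)) \<longlonglongrightarrow> 0"
    "\<And>k. (\<lambda>m. L2_norm \<Omega> (classical_partial k (\<phi> m) - weak_partial \<Omega> k u)) \<longlonglongrightarrow> 0"
    using W10_approximation[OF assms(1,3)] by metis
  have hwp: "has_weak_partial \<Omega> k u (weak_partial \<Omega> k u)" for k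
    using assms by (auto intro: W1_has_weak_partial simp: W10_def)
  have q: "q $ k \<in> L2 \<Omega>" for k
    using assms(2) by (simp add: nabla0_adj_graph_iff L2n_def)
  have g: "g \<in> L2 \<Omega>"
    using assms(2) by (simp add: nabla0_adj_graph_iff)
  have L2: "u \<in> L2 \<Omega>" "weak_partial \<Omega> k u \<in> L2 \<Omega>" for k
    using hwp by (auto simp: has_weak_partial_def)
  have "(\<lambda>m. \<Sum>k\<in>UNIV. L2_inner \<Omega> (q $ k) (classical_partial k (\<phi> m)))
      \<longlonglongrightarrow> (\<Sum>k\<in>UNIV. L2_inner \<Omega> (q $ k) (weak_partial \<Omega> k u))"
    by (intro tendsto_sum L2_inner_tendsto_right L2 q \<phi> test_functions_partial_L2 assms(1))
  moreover have "(\<lambda>m. L2_inner \<Omega> g (\<phi> m)) \<longlonglongrightarrow> L2_inner \<Omega> g u"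
    by (intro L2_inner_tendsto_right L2 g \<phi> test_functions_L2 assms(1))
  moreover have "(\<Sum>k\<in>UNIV. L2_inner \<Omega> (q $ k) (classical_partial k (\<phi> m))) = L2_inner \<Omega> g (\<phi> m)" for m
    using assms(2) \<phi>(1) by (simp add: nabla0_adj_graph_iff)
  ultimately have "(\<Sum>k\<in>UNIV. L2_inner \<Omega> (q $ k) (weak_partial \<Omega> k u)) = L2_inner \<Omega> g u"
    by (auto intro: LIMSEQ_unique)
  then show ?thesis by (simp add: L2n_inner_def nabla_w_def)
qed

section \<open>Solvability of the equation\<close>

text \<open>The core of the Riesz representation theorem in a space that need not be complete, so that it
  applies to test functions. The energy \<open>J f = B f f - 2 L f\<close> is bounded below because \<open>L\<close> is bounded
  with respect to \<open>B\<close>. The parallelogram law makes a minimizing sequence a Cauchy sequence, and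
  comparing its members with their perturbations by \<open>t f\<close> yields, through a discriminant, the
  approximate Euler--Lagrange equation.\<close>

lemma minimizing_sequence:
  fixes S :: "('a \<Rightarrow> complex) set" and B :: "('a \<Rightarrow> complex) \<Rightarrow> ('a \<Rightarrow> complex) \<Rightarrow> real"
    and L :: "('a \<Rightarrow> complex) \<Rightarrow> real"
  assumes "(\<lambda>x. 0) \<in> S"
    and S_add: "\<And>f g. f \<in> S \<Longrightarrow> g \<in> S \<Longrightarrow> (\<lambda>x. f x + g x) \<in> S"
    and S_scale: "\<And>f c. f \<in> S \<Longrightarrow> (\<lambda>x. of_real c * f x) \<in> S"
    and B_sym: "\<And>f g. f \<in> S \<Longrightarrow> g \<in> S \<Longrightarrow> B f g = B g f"
    and B_add: "\<And>f g h. f \<in> S \<Longrightarrow> g \<in> S \<Longrightarrow> h \<in> S \<Longrightarrow> B (\<lambda>x. f x + g x) h = B f h + B g h"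
    and B_scale: "\<And>f g c. f \<in> S \<Longrightarrow> g \<in> S \<Longrightarrow> B (\<lambda>x. of_real c * f x) g = c * B f g"
    and B_nonneg: "\<And>f. f \<in> S \<Longrightarrow> 0 \<le> B f f"
    and L_add: "\<And>f g. f \<in> S \<Longrightarrow> g \<in> S \<Longrightarrow> L (\<lambda>x. f x + g x) = L f + L g"
    and L_scale: "\<And>f c. f \<in> S \<Longrightarrow> L (\<lambda>x. of_real c * f x) = c * L f"
    and "0 \<le> C" and L_bound: "\<And>f. f \<in> S \<Longrightarrow> (L f)\<^sup>2 \<le> C * B f f"
  obtains \<phi> where "\<And>m::nat. \<phi> m \<in> S"
    and "\<And>e. e > 0 \<Longrightarrow> \<exists>N. \<forall>m\<ge>N. \<forall>n\<ge>N. B (\<phi> m - \<phi> n) (\<phi> m - \<phi> n) < e"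
    and "\<And>f. f \<in> S \<Longrightarrow> (\<lambda>m. B (\<phi> m) f) \<longlonglongrightarrow> L f"
proof -
  define J where "J f = B f f - 2 * L f" for f
  have B_sq: "B (\<lambda>x. f x + of_real t * g x) (\<lambda>x. f x + of_real t * g x)
      = B f f + 2 * t * B f g + t\<^sup>2 * B g g" if "f \<in> S" "g \<in> S" for f g t
  proof -
    have tg: "(\<lambda>x. of_real t * g x) \<in> S" and fg: "(\<lambda>x. f x + of_real t * g x) \<in> S"
      using that by (auto intro: S_add S_scale)
    have "B (\<lambda>x. f x + of_real t * g x) (\<lambda>x. f x + of_real t * g x)
        = B (\<lambda>x. f x + of_real t * g x) f + t * B (\<lambda>x. f x + of_real t * g x) g"
      using that tg fg B_add[of f "\<lambda>x. of_real t * g x" "\<lambda>x. f x + of_real t * g x"]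
        B_scale[of g "\<lambda>x. f x + of_real t * g x" t]
        B_sym[of f "\<lambda>x. f x + of_real t * g x"] B_sym[of g "\<lambda>x. f x + of_real t * g x"] by simp
    also have "\<dots> = B f f + t * B g f + t * (B f g + t * B g g)"
      using that tg by (simp add: B_add B_scale)
    finally show ?thesis
      using B_sym[OF that] by (simp add: algebra_simps power2_eq_square)
  qed
  have J_line: "J (\<lambda>x. f x + of_real t * g x) = J f + 2 * t * (B f g - L g) + t\<^sup>2 * B g g"
    if "f \<in> S" "g \<in> S" for f g t
    unfolding J_def B_sq[OF that] using that
    by (simp add: L_add[OF _ S_scale] L_scale algebra_simps)
  have J_bounded: "- C \<le> J f" if "f \<in> S" for f
  proof -
    have "L f \<le> sqrt ((L f)\<^sup>2)" by simp
    also have "\<dots> \<le> sqrt (C * B f f)"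
      using L_bound[OF that] by (rule real_sqrt_le_mono)
    finally have "2 * L f \<le> 2 * sqrt C * sqrt (B f f)"
      by (simp add: real_sqrt_mult)
    also have "\<dots> \<le> C + B f f"
      using sum_squares_bound[of "sqrt C" "sqrt (B f f)"] \<open>0 \<le> C\<close> B_nonneg[OF that] by simp
    finally show ?thesis by (simp add: J_def)
  qed
  define d where "d = (INF f\<in>S. J f)"
  have bdd: "bdd_below (J ` S)"
    using J_bounded by (intro bdd_belowI2[where m = "- C"])
  have d_le: "d \<le> J f" if "f \<in> S" for f
    unfolding d_def using bdd that by (rule cINF_lower)
  have "\<exists>f\<in>S. J f < d + inverse (real (Suc m))" for m
  proof -
    have "(INF f\<in>S. J f) < d + inverse (real (Suc m))"
      by (simp add: d_def)
    then show ?thesis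
      using bdd assms(1) by (subst (asm) cINF_less_iff) auto
  qed
  then obtain \<phi> where \<phi>: "\<And>m. \<phi> m \<in> S" and J_\<phi>: "\<And>m. J (\<phi> m) < d + inverse (real (Suc m))"
    by metis
  have diff: "f - g \<in> S" if "f \<in> S" "g \<in> S" for f g
    using S_add[OF that(1) S_scale[OF that(2), of "- 1"]] by (simp add: fun_diff_def)
  have parallelogram: "B (g - f) (g - f) \<le> 2 * (J f - d) + 2 * (J g - d)" if "f \<in> S" "g \<in> S" for f g
  proof -
    let ?e = "g - f"
    have e: "?e \<in> S" using that by (intro diff)
    \<comment> \<open>The energy at the midpoint is compared with the infimum.\<close>
    have "d \<le> J (\<lambda>x. f x + of_real (1/2) * ?e x)"
      by (intro d_le S_add S_scale e that)
    then have "d \<le> J f + (B f ?e - L ?e) + B ?e ?e / 4"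
      unfolding J_line[OF that(1) e] by (simp add: power2_eq_square)
    moreover have "J g = J f + 2 * (B f ?e - L ?e) + B ?e ?e"
      using J_line[OF that(1) e, of 1] by (simp add: fun_diff_def)
    ultimately show ?thesis by (simp add: field_simps)
  qed
  show thesis
  proof (rule that[OF \<phi>])
    fix e :: real assume "e > 0"
    then obtain N where N: "inverse (real (Suc N)) < e / 4"
      using reals_Archimedean[of "e / 4"] by auto
    have near: "J (\<phi> m) - d < e / 4" if "m \<ge> N" for m
    proof -
      have "inverse (real (Suc m)) \<le> inverse (real (Suc N))"
        using that by simp
      then show ?thesis using N J_\<phi>[of m] by linarith
    qed
    have "B (\<phi> m - \<phi> n) (\<phi> m - \<phi> n) < e" if "m \<ge> N" "n \<ge> N" for m n
    proof (rule le_less_trans[OF parallelogram[OF \<phi> \<phi>]])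
      show "2 * (J (\<phi> n) - d) + 2 * (J (\<phi> m) - d) < e"
        using near[OF that(1)] near[OF that(2)]
        by (simp add: field_simps)
    qed
    then show "\<exists>N. \<forall>m\<ge>N. \<forall>n\<ge>N. B (\<phi> m - \<phi> n) (\<phi> m - \<phi> n) < e" by blast
  next
    fix f assume f: "f \<in> S"
    have bound: "(B (\<phi> m) f - L f)\<^sup>2 \<le> B f f * inverse (real (Suc m))" for m
    proof (rule discriminant_bound[OF B_nonneg[OF f]])
      fix t
      have "d \<le> J (\<lambda>x. \<phi> m x + of_real t * f x)"
        by (intro d_le S_add S_scale \<phi> f)
      with J_\<phi>[of m] show "0 \<le> B f f * t\<^sup>2 + 2 * (B (\<phi> m) f - L f) * t + inverse (real (Suc m))"
        unfolding J_line[OF \<phi> f] by (simp add: algebra_simps)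
    qed
    have "(\<lambda>m. (B (\<phi> m) f - L f)\<^sup>2) \<longlonglongrightarrow> 0"
      using bound
      by (intro Lim_null_comparison[OF always_eventually
            tendsto_mult_right_zero[OF LIMSEQ_inverse_real_of_nat]] allI) simp
    from tendsto_real_sqrt[OF this] have "(\<lambda>m. B (\<phi> m) f - L f) \<longlonglongrightarrow> 0"
      by (simp add: tendsto_rabs_zero_iff)
    then show "(\<lambda>m. B (\<phi> m) f) \<longlonglongrightarrow> L f"
      by (simp add: LIM_zero_iff)
  qed
qed

lemma L2_inner_mult_lower_bound:
  assumes f: "f \<in> L2 \<Omega>" and p: "p \<in> borel_measurable (lebesgue_on \<Omega>)"
    and bound: "AE x in lebesgue_on \<Omega>. \<bar>p x\<bar> \<le> K" and lower: "AE x in lebesgue_on \<Omega>. a \<le> p x"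
  shows "a * (L2_norm \<Omega> f)\<^sup>2 \<le> Re (L2_inner \<Omega> f (\<lambda>x. of_real (p x) * f x))"
proof -
  have int: "integrable (lebesgue_on \<Omega>) (\<lambda>x. cnj (f x) * (of_real (p x) * f x))"
    using f p bound by (intro L2_mult_integrable L2_bounded_mult)
  have eq: "Re (cnj (f x) * (of_real (p x) * f x)) = p x * (cmod (f x))\<^sup>2" for x
    unfolding mult.left_commute[of "cnj (f x)"]
    by (simp add: cmod_power2 flip: power2_eq_square)
  have "a * (L2_norm \<Omega> f)\<^sup>2 = (LINT x|lebesgue_on \<Omega>. a * (cmod (f x))\<^sup>2)"
    by (simp add: L2_norm_sq)
  also have "\<dots> \<le> (LINT x|lebesgue_on \<Omega>. p x * (cmod (f x))\<^sup>2)"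
  proof (rule integral_mono_AE)
    show "integrable (lebesgue_on \<Omega>) (\<lambda>x. a * (cmod (f x))\<^sup>2)"
      using f by (simp add: L2_sq_integrable)
    show "integrable (lebesgue_on \<Omega>) (\<lambda>x. p x * (cmod (f x))\<^sup>2)"
      using integrable_Re[OF int] unfolding eq .
    show "AE x in lebesgue_on \<Omega>. a * (cmod (f x))\<^sup>2 \<le> p x * (cmod (f x))\<^sup>2"
      using lower by eventually_elim (simp add: mult_right_mono)
  qed
  also have "\<dots> = Re (L2_inner \<Omega> f (\<lambda>x. of_real (p x) * f x))"
    unfolding L2_inner_def using integral_Re[OF int] by (simp only: eq)
  finally show ?thesis .
qed

lemma L_classD:
  assumes "p \<in> L_class \<Omega>"
  obtains a b where "0 < a" "a \<le> b" "p \<in> borel_measurable (lebesgue_on \<Omega>)"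
    "AE x in lebesgue_on \<Omega>. a \<le> p x \<and> p x \<le> b"
  using assms by (auto simp: L_class_def Linf_def)

text \<open>In the application \<open>w = 1 / p\<close>. The form \<open>B\<close> controls all partial derivatives of a test function,
  and through the Poincare inequality the function itself; hence \<open>L\<close> is bounded, and a Cauchy sequence for
  \<open>B\<close> is one in the norm of \<open>W\<^sup>1\<close>.\<close>

lemma divergence_equation_solution:
  fixes \<Omega> :: "(real^'n::finite) set" and w :: "real^'n \<Rightarrow> real" and g :: "'n cvec"
  assumes "open \<Omega>" and poin: "poincare \<Omega> j c"
    and w: "w \<in> borel_measurable (lebesgue_on \<Omega>)" and "0 < a"
    and w_bounds: "AE x in lebesgue_on \<Omega>. a \<le> w x" "AE x in lebesgue_on \<Omega>. \<bar>w x\<bar> \<le> K"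
    and f: "f \<in> L2 \<Omega>" and g: "g \<in> L2n \<Omega>"
  obtains u v where "u \<in> W10 \<Omega>" "\<And>k. has_weak_partial \<Omega> k u (v k)"
    "((\<chi> k. (\<lambda>x. of_real (w x) * (v k x - (g $ k) x))), f) \<in> nabla0_adj_graph \<Omega>"
proof -
  let ?T = "test_functions \<Omega>" and ?d = "classical_partial"
  let ?w = "\<lambda>f x. complex_of_real (w x) * f x"
  have wL2: "?w h \<in> L2 \<Omega>" if "h \<in> L2 \<Omega>" for h
    using that w w_bounds(2) by (rule L2_bounded_mult)
  have gk: "g $ k \<in> L2 \<Omega>" for k
    using g by (simp add: L2n_def)
  note T_L2 = test_functions_L2[OF \<open>open \<Omega>\<close>] test_functions_partial_L2[OF \<open>open \<Omega>\<close>]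
  have "0 \<le> \<bar>K\<bar>" by simp
  have w_bound: "AE x in lebesgue_on \<Omega>. \<bar>w x\<bar> \<le> \<bar>K\<bar>"
    using w_bounds(2) by eventually_elim simp
  have "0 < c" using poin by (simp add: poincare_def)
  define G where "G \<phi> = (\<Sum>k\<in>UNIV. (L2_norm \<Omega> (?d k \<phi>))\<^sup>2)" for \<phi>
  define B where "B \<phi> \<psi> = (\<Sum>k\<in>UNIV. Re (L2_inner \<Omega> (?d k \<phi>) (?w (?d k \<psi>))))" for \<phi> \<psi>
  define L where "L \<psi> = Re (L2_inner \<Omega> f \<psi>) + (\<Sum>k\<in>UNIV. Re (L2_inner \<Omega> (g $ k) (?w (?d k \<psi>))))" for \<psi>
  have G_nonneg: "0 \<le> G \<phi>" for \<phi>
    by (simp add: G_def sum_nonneg)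
  have d_le_G: "L2_norm \<Omega> (?d k \<phi>) \<le> sqrt (G \<phi>)" for k \<phi>
    unfolding G_def by (intro real_le_rsqrt member_le_sum) auto
  have coercive: "a * G \<phi> \<le> B \<phi> \<phi>" if "\<phi> \<in> ?T" for \<phi>
    unfolding G_def B_def sum_distrib_left
    by (intro sum_mono L2_inner_mult_lower_bound[OF _ w w_bounds(2,1)] T_L2 that)
  define D where "D = L2_norm \<Omega> f / c + (\<Sum>k\<in>UNIV. L2_norm \<Omega> (g $ k) * \<bar>K\<bar>)"
  have L_bound: "(L \<psi>)\<^sup>2 \<le> D\<^sup>2 / a * B \<psi> \<psi>" if "\<psi> \<in> ?T" for \<psi>
  proof -
    have "\<bar>L \<psi>\<bar> \<le> \<bar>Re (L2_inner \<Omega> f \<psi>)\<bar> + (\<Sum>k\<in>UNIV. \<bar>Re (L2_inner \<Omega> (g $ k) (?w (?d k \<psi>)))\<bar>)"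
      unfolding L_def by (intro order_trans[OF abs_triangle_ineq] add_left_mono sum_abs)
    also have "\<dots> \<le> L2_norm \<Omega> f * (sqrt (G \<psi>) / c)
        + (\<Sum>k\<in>UNIV. L2_norm \<Omega> (g $ k) * (\<bar>K\<bar> * sqrt (G \<psi>)))"
    proof (intro add_mono sum_mono)
      have "\<bar>Re (L2_inner \<Omega> f \<psi>)\<bar> \<le> L2_norm \<Omega> f * L2_norm \<Omega> \<psi>"
        by (intro order_trans[OF abs_Re_le_cmod] L2_Cauchy_Schwarz f T_L2 that)
      also have "\<dots> \<le> L2_norm \<Omega> f * (sqrt (G \<psi>) / c)"
        using \<open>0 < c\<close> poincare_test_function[OF \<open>open \<Omega>\<close> poin that]
          divide_right_mono[OF d_le_G[of j \<psi>], of c]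
        by (intro mult_left_mono L2_norm_nonneg) linarith
      finally show "\<bar>Re (L2_inner \<Omega> f \<psi>)\<bar> \<le> L2_norm \<Omega> f * (sqrt (G \<psi>) / c)" .
      fix k
      have "\<bar>Re (L2_inner \<Omega> (g $ k) (?w (?d k \<psi>)))\<bar> \<le> L2_norm \<Omega> (g $ k) * L2_norm \<Omega> (?w (?d k \<psi>))"
        by (intro order_trans[OF abs_Re_le_cmod] L2_Cauchy_Schwarz gk wL2 T_L2 that)
      also have "\<dots> \<le> L2_norm \<Omega> (g $ k) * (\<bar>K\<bar> * sqrt (G \<psi>))"
        using L2_norm_bounded_mult[OF T_L2(2)[OF that] w w_bound \<open>0 \<le> \<bar>K\<bar>\<close>, of k]
          mult_left_mono[OF d_le_G \<open>0 \<le> \<bar>K\<bar>\<close>, of k \<psi>]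
        by (intro mult_left_mono L2_norm_nonneg) linarith
      finally show "\<bar>Re (L2_inner \<Omega> (g $ k) (?w (?d k \<psi>)))\<bar> \<le> L2_norm \<Omega> (g $ k) * (\<bar>K\<bar> * sqrt (G \<psi>))" .
    qed
    also have "\<dots> = D * sqrt (G \<psi>)"
      by (simp add: D_def distrib_right sum_distrib_right mult.assoc)
    finally have "\<bar>L \<psi>\<bar>\<^sup>2 \<le> (D * sqrt (G \<psi>))\<^sup>2"
      by (intro power_mono) auto
    also have "\<dots> = D\<^sup>2 / a * (a * G \<psi>)"
      using \<open>0 < a\<close> G_nonneg by (simp add: power_mult_distrib)
    also have "\<dots> \<le> D\<^sup>2 / a * B \<psi> \<psi>"
      using coercive[OF that] \<open>0 < a\<close> by (intro mult_left_mono) auto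
    finally show ?thesis by simp
  qed
  obtain \<phi> where \<phi>: "\<And>m::nat. \<phi> m \<in> ?T"
    and cauchy: "\<And>e. e > 0 \<Longrightarrow> \<exists>N. \<forall>m\<ge>N. \<forall>n\<ge>N. B (\<phi> m - \<phi> n) (\<phi> m - \<phi> n) < e"
    and lim: "\<And>\<psi>. \<psi> \<in> ?T \<Longrightarrow> (\<lambda>m. B (\<phi> m) \<psi>) \<longlonglongrightarrow> L \<psi>"
  proof (rule minimizing_sequence[of ?T B L "D\<^sup>2 / a"])
    show "B \<phi> \<psi> = B \<psi> \<phi>" if "\<phi> \<in> ?T" "\<psi> \<in> ?T" for \<phi> \<psi>
    proof -
      have "Re (L2_inner \<Omega> (?d k \<phi>) (?w (?d k \<psi>))) = Re (L2_inner \<Omega> (?d k \<psi>) (?w (?d k \<phi>)))" for k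
        by (subst L2_inner_real_mult, subst L2_inner_commute) simp
      then show ?thesis by (simp add: B_def)
    qed
    show "B (\<lambda>x. \<phi> x + \<psi> x) \<eta> = B \<phi> \<eta> + B \<psi> \<eta>" if "\<phi> \<in> ?T" "\<psi> \<in> ?T" "\<eta> \<in> ?T" for \<phi> \<psi> \<eta>
      using that
      by (simp add: B_def test_functions_classical_partial_add L2_inner_add_left T_L2 wL2 sum.distrib)
    show "B (\<lambda>x. complex_of_real t * \<phi> x) \<psi> = t * B \<phi> \<psi>" if "\<phi> \<in> ?T" "\<psi> \<in> ?T" for \<phi> \<psi> t
      using that
      by (simp add: B_def test_functions_classical_partial_scale L2_inner_scale_left sum_distrib_left)
    show "0 \<le> B \<phi> \<phi>" if "\<phi> \<in> ?T" for \<phi>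
      using coercive[OF that] G_nonneg[of \<phi>] \<open>0 < a\<close> by (meson less_imp_le mult_nonneg_nonneg order_trans)
    show "L (\<lambda>x. \<phi> x + \<psi> x) = L \<phi> + L \<psi>" if "\<phi> \<in> ?T" "\<psi> \<in> ?T" for \<phi> \<psi>
      using that
      by (simp add: L_def test_functions_classical_partial_add distrib_left L2_inner_add_right
          T_L2 wL2 f gk sum.distrib)
    show "L (\<lambda>x. complex_of_real t * \<phi> x) = t * L \<phi>" if "\<phi> \<in> ?T" for \<phi> t
      using that
      by (simp add: L_def test_functions_classical_partial_scale mult.left_commute[of _ "of_real t"]
          L2_inner_scale_right sum_distrib_left distrib_left)
  qed (use \<open>0 < a\<close> L_bound in \<open>auto intro: test_functions_add test_functions_scale test_functions_zero\<close>)
  have d_cauchy: "\<exists>N. \<forall>m\<ge>N. \<forall>n\<ge>N. L2_norm \<Omega> (?d k (\<phi> m) - ?d k (\<phi> n)) < e" if "e > 0" for e k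
  proof -
    obtain N where N: "\<And>m n. m \<ge> N \<Longrightarrow> n \<ge> N \<Longrightarrow> B (\<phi> m - \<phi> n) (\<phi> m - \<phi> n) < a * e\<^sup>2"
      using cauchy[of "a * e\<^sup>2"] \<open>0 < a\<close> \<open>e > 0\<close> by auto
    have "L2_norm \<Omega> (?d k (\<phi> m) - ?d k (\<phi> n)) < e" if "m \<ge> N" "n \<ge> N" for m n
    proof -
      have "a * G (\<phi> m - \<phi> n) < a * e\<^sup>2"
        using N[OF that] coercive[OF test_functions_diff[OF \<phi> \<phi>], of m n] by linarith
      then have "sqrt (G (\<phi> m - \<phi> n)) < e"
        using \<open>0 < a\<close> \<open>e > 0\<close> by (intro real_less_lsqrt) auto
      with d_le_G[of k "\<phi> m - \<phi> n"] show ?thesis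
        by (simp add: test_functions_classical_partial_diff[OF \<phi> \<phi>])
    qed
    then show ?thesis by blast
  qed
  have "\<exists>v\<in>L2 \<Omega>. (\<lambda>m. L2_norm \<Omega> (?d k (\<phi> m) - v)) \<longlonglongrightarrow> 0" for k
    by (rule L2_complete[OF T_L2(2)[OF \<phi>] d_cauchy, of k]) (assumption, rule bexI)
  then obtain v where v: "\<And>k. v k \<in> L2 \<Omega>" and v_lim: "\<And>k. (\<lambda>m. L2_norm \<Omega> (?d k (\<phi> m) - v k)) \<longlonglongrightarrow> 0"
    by metis
  have \<phi>_cauchy: "\<exists>N. \<forall>m\<ge>N. \<forall>n\<ge>N. L2_norm \<Omega> (\<phi> m - \<phi> n) < e" if "e > 0" for e
  proof -
    obtain N where N: "\<And>m n. m \<ge> N \<Longrightarrow> n \<ge> N \<Longrightarrow> L2_norm \<Omega> (?d j (\<phi> m) - ?d j (\<phi> n)) < c * e"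
      using d_cauchy[of "c * e" j] \<open>0 < c\<close> \<open>e > 0\<close> by auto
    have "L2_norm \<Omega> (\<phi> m - \<phi> n) < e" if "m \<ge> N" "n \<ge> N" for m n
    proof -
      have "L2_norm \<Omega> (\<phi> m - \<phi> n) \<le> L2_norm \<Omega> (?d j (\<phi> m) - ?d j (\<phi> n)) / c"
        using poincare_test_function[OF \<open>open \<Omega>\<close> poin test_functions_diff[OF \<phi> \<phi>]]
        by (simp add: test_functions_classical_partial_diff[OF \<phi> \<phi>])
      also have "\<dots> < e"
        using N[OF that] \<open>0 < c\<close> by (simp add: pos_divide_less_eq mult.commute)
      finally show ?thesis .
    qed
    then show ?thesis by blast
  qed
  obtain u where u: "u \<in> L2 \<Omega>" and u_lim: "(\<lambda>m. L2_norm \<Omega> (\<phi> m - u)) \<longlonglongrightarrow> 0"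
    by (rule L2_complete[OF T_L2(1)[OF \<phi>] \<phi>_cauchy]) (assumption, rule that)
  have hwp: "has_weak_partial \<Omega> k u (v k)" for k
    by (rule has_weak_partial_limit[OF \<open>open \<Omega>\<close>
          test_functions_has_weak_partial[OF \<open>open \<Omega>\<close> \<phi>] u v u_lim v_lim])
  have "u \<in> W10 \<Omega>"
    by (rule W10_I[OF \<open>open \<Omega>\<close> hwp \<phi> u_lim v_lim])
  moreover
  define q where "q k = ?w (\<lambda>x. v k x - (g $ k) x)" for k
  have q: "q k \<in> L2 \<Omega>" for k
    unfolding q_def using L2_diff[OF v gk] by (intro wL2) (simp add: fun_diff_def)
  have q_inner: "L2_inner \<Omega> (q k) h = L2_inner \<Omega> (v k) (?w h) - L2_inner \<Omega> (g $ k) (?w h)"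
    if "h \<in> L2 \<Omega>" for k h
    using L2_inner_diff_left[OF wL2[OF that] v gk, of k]
    by (simp add: q_def L2_inner_real_mult[symmetric] fun_diff_def)
  have re: "Re (\<Sum>k\<in>UNIV. L2_inner \<Omega> (q k) (?d k \<psi>)) = Re (L2_inner \<Omega> f \<psi>)" if "\<psi> \<in> ?T" for \<psi>
  proof -
    have "(\<lambda>m. B (\<phi> m) \<psi>) \<longlonglongrightarrow> (\<Sum>k\<in>UNIV. Re (L2_inner \<Omega> (v k) (?w (?d k \<psi>))))"
      unfolding B_def
      by (intro tendsto_sum tendsto_Re L2_inner_tendsto_left v v_lim T_L2 wL2 \<phi> that)
    from LIMSEQ_unique[OF this lim[OF that]]
    show ?thesis
      using that by (simp add: L_def q_inner T_L2 sum_subtractf)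
  qed
  have "(\<Sum>k\<in>UNIV. L2_inner \<Omega> (q k) (?d k \<psi>)) = L2_inner \<Omega> f \<psi>" if \<psi>: "\<psi> \<in> ?T" for \<psi>
  proof (rule complex_eqI)
    show "Re (\<Sum>k\<in>UNIV. L2_inner \<Omega> (q k) (?d k \<psi>)) = Re (L2_inner \<Omega> f \<psi>)"
      by (rule re[OF \<psi>])
    \<comment> \<open>The forms \<open>B\<close> and \<open>L\<close> only see real parts; the test function \<open>\<i> \<psi>\<close> supplies the imaginary one.\<close>
    show "Im (\<Sum>k\<in>UNIV. L2_inner \<Omega> (q k) (?d k \<psi>)) = Im (L2_inner \<Omega> f \<psi>)"
      using re[OF test_functions_scale[OF \<psi>, of \<i>]]
      by (simp add: test_functions_classical_partial_scale[OF \<psi>] L2_inner_scale_right sum_negf)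
  qed
  then have "((\<chi> k. q k), f) \<in> nabla0_adj_graph \<Omega>"
    using q f by (simp add: nabla0_adj_graph_iff L2n_def)
  ultimately show thesis
    using hwp by (intro that[of u v]) (simp_all add: q_def)
qed

lemma A_hat_surjective:
  fixes \<Omega> :: "(real^'n::finite) set"
  assumes "open \<Omega>" "poincare \<Omega> j c" "p \<in> L_class \<Omega>" "\<xi> \<in> H_space \<Omega>"
  obtains x where "x \<in> A_hat_dom \<Omega>" "H_eq \<Omega> (A_hat \<Omega> p x) \<xi>"
proof -
  obtain a b where ab: "0 < a" "a \<le> b" and p: "p \<in> borel_measurable (lebesgue_on \<Omega>)"
    and bounds: "AE x in lebesgue_on \<Omega>. a \<le> p x \<and> p x \<le> b"
    by (rule L_classD[OF assms(3)]) (rule that)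
  have "0 < 1 / b" using ab by simp
  have f: "fst \<xi> \<in> L2 \<Omega>" and g: "snd \<xi> \<in> L2n \<Omega>"
    using assms(4) by (auto simp: H_space_def)
  have w: "(\<lambda>x. 1 / p x) \<in> borel_measurable (lebesgue_on \<Omega>)"
    using p by measurable
  have lower: "AE x in lebesgue_on \<Omega>. 1 / b \<le> 1 / p x"
    using bounds by eventually_elim (use ab in \<open>auto intro: divide_left_mono\<close>)
  have upper: "AE x in lebesgue_on \<Omega>. \<bar>1 / p x\<bar> \<le> 1 / a"
    using bounds by eventually_elim (use ab in \<open>auto intro: divide_left_mono\<close>)
  obtain u v where u: "u \<in> W10 \<Omega>" and v: "\<And>k. has_weak_partial \<Omega> k u (v k)"
    and q: "((\<chi> k. (\<lambda>x. of_real (1 / p x) * (v k x - (snd \<xi> $ k) x))), fst \<xi>) \<in> nabla0_adj_graph \<Omega>"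
    by (rule divergence_equation_solution[OF assms(1,2) w \<open>0 < 1 / b\<close> lower upper f g])
      (rule that)
  define q' where "q' = (\<chi> k. (\<lambda>x. of_real (1 / p x) * (v k x - (snd \<xi> $ k) x)))"
  note q = q[folded q'_def]
  show thesis
  proof (rule that[of "(u, q')"])
    show "(u, q') \<in> A_hat_dom \<Omega>"
      using u q by (auto simp: A_hat_dom_def nabla0_adj_dom_def)
    have "AE x in lebesgue_on \<Omega>. weak_partial \<Omega> k u x - of_real (p x) * (q' $ k) x = (snd \<xi> $ k) x" for k
      using weak_partial_AE[OF assms(1) v[of k]] bounds
      by eventually_elim (use ab in \<open>auto simp: q'_def\<close>)
    then show "H_eq \<Omega> (A_hat \<Omega> p (u, q')) \<xi>"
      using nabla0_adj_AE[OF assms(1) q]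
      by (simp add: H_eq_def A_hat_def nabla_w_def)
  qed
qed

lemma A_hat_inv_solves:
  assumes "open \<Omega>" "poincare \<Omega> j c" "p \<in> L_class \<Omega>" "\<xi> \<in> H_space \<Omega>"
  shows "A_hat_inv \<Omega> p \<xi> \<in> A_hat_dom \<Omega>" "H_eq \<Omega> (A_hat \<Omega> p (A_hat_inv \<Omega> p \<xi>)) \<xi>"
proof -
  have "\<exists>x. x \<in> A_hat_dom \<Omega> \<and> H_eq \<Omega> (A_hat \<Omega> p x) \<xi>"
    using A_hat_surjective[OF assms] by metis
  from someI_ex[OF this]
  show "A_hat_inv \<Omega> p \<xi> \<in> A_hat_dom \<Omega>" "H_eq \<Omega> (A_hat \<Omega> p (A_hat_inv \<Omega> p \<xi>)) \<xi>"
    by (auto simp: A_hat_inv_def)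
qed

section \<open>Dependence on the coefficient\<close>

text \<open>The difference of the solutions is tested with its own second component, which is orthogonal to
  the gradient of the first one. The case \<open>p = p'\<close> says that the solution is unique up to equality almost
  everywhere.\<close>

lemma A_hat_stability:
  fixes \<Omega> :: "(real^'n::finite) set"
  assumes "open \<Omega>" "poincare \<Omega> j c"
    and p: "p \<in> borel_measurable (lebesgue_on \<Omega>)" and "0 < \<epsilon>" "0 \<le> M"
    and p_bounds: "AE x in lebesgue_on \<Omega>. \<epsilon> \<le> p x" "AE x in lebesgue_on \<Omega>. \<bar>p x\<bar> \<le> M"
    and p': "p' \<in> borel_measurable (lebesgue_on \<Omega>)" "AE x in lebesgue_on \<Omega>. \<bar>p' x\<bar> \<le> M"
    and x: "x \<in> A_hat_dom \<Omega>" "H_eq \<Omega> (A_hat \<Omega> p x) \<xi>"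
    and y: "y \<in> A_hat_dom \<Omega>" "H_eq \<Omega> (A_hat \<Omega> p' y) \<xi>"
  shows "H_norm \<Omega> (x - y) \<le> ((M / \<epsilon> + 1) / c + 1 / \<epsilon>) *
    L2n_norm \<Omega> (\<chi> k. (\<lambda>t. of_real (p t - p' t) * (snd y $ k) t))"
proof -
  define h :: "'n cvec" where "h = (\<chi> k. (\<lambda>t. of_real (p t - p' t) * (snd y $ k) t))"
  define w where "w = fst x - fst y"
  define r where "r = snd x - snd y"
  have "0 < c" using assms(2) by (simp add: poincare_def)
  have dom: "fst x \<in> W10 \<Omega>" "fst y \<in> W10 \<Omega>" "snd x \<in> nabla0_adj_dom \<Omega>" "snd y \<in> nabla0_adj_dom \<Omega>"
    using x(1) y(1) by (auto simp: A_hat_dom_def)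
  have w: "w \<in> W10 \<Omega>"
    unfolding w_def by (intro W10_diff dom assms(1))
  note gx = nabla0_adj_graph_nabla0_adj[OF dom(3)]
  note gy = nabla0_adj_graph_nabla0_adj[OF dom(4)]
  have L2q: "snd x $ k \<in> L2 \<Omega>" "snd y $ k \<in> L2 \<Omega>" "nabla0_adj \<Omega> (snd x) \<in> L2 \<Omega>" "nabla0_adj \<Omega> (snd y) \<in> L2 \<Omega>" for k
    using gx gy by (auto simp: nabla0_adj_graph_iff L2n_def)
  have r: "r $ k \<in> L2 \<Omega>" for k
    unfolding r_def vector_minus_component by (intro L2_diff L2q)
  have hwp: "has_weak_partial \<Omega> k (fst x) (weak_partial \<Omega> k (fst x))"
    "has_weak_partial \<Omega> k (fst y) (weak_partial \<Omega> k (fst y))"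
    "has_weak_partial \<Omega> k w (weak_partial \<Omega> k w)" for k
    using dom w by (auto intro: W1_has_weak_partial simp: W10_def)
  have wL2: "weak_partial \<Omega> k w \<in> L2 \<Omega>" for k
    using hwp(3) by (simp add: has_weak_partial_def)
  have p_diff: "AE t in lebesgue_on \<Omega>. \<bar>p t - p' t\<bar> \<le> 2 * M"
    using p_bounds(2) p'(2) by eventually_elim linarith
  have h: "h $ k \<in> L2 \<Omega>" for k
    unfolding h_def vec_lambda_beta
    by (rule L2_bounded_mult[OF L2q(2) _ p_diff]) (use p p'(1) in measurable)
  have pr: "(\<lambda>t. of_real (p t) * (r $ k) t) \<in> L2 \<Omega>" for k
    using r p p_bounds(2) by (rule L2_bounded_mult)
  \<comment> \<open>The difference of the two solutions has the right-hand side \<open>(0, h)\<close>.\<close>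
  have adj_eq: "AE t in lebesgue_on \<Omega>. nabla0_adj \<Omega> (snd x) t = nabla0_adj \<Omega> (snd y) t"
  proof -
    have "AE t in lebesgue_on \<Omega>. nabla0_adj \<Omega> (snd x) t = fst \<xi> t"
      "AE t in lebesgue_on \<Omega>. nabla0_adj \<Omega> (snd y) t = fst \<xi> t"
      using x(2) y(2) by (auto simp: H_eq_def A_hat_def split_beta)
    then show ?thesis by eventually_elim simp
  qed
  have grad_eq: "AE t in lebesgue_on \<Omega>. weak_partial \<Omega> k w t = of_real (p t) * (r $ k) t + (h $ k) t" for k
  proof -
    have "AE t in lebesgue_on \<Omega>. weak_partial \<Omega> k (fst x) t - of_real (p t) * (snd x $ k) t = (snd \<xi> $ k) t"
      "AE t in lebesgue_on \<Omega>. weak_partial \<Omega> k (fst y) t - of_real (p' t) * (snd y $ k) t = (snd \<xi> $ k) t"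
      using x(2) y(2) by (auto simp: H_eq_def A_hat_def split_beta nabla_w_def)
    moreover have "AE t in lebesgue_on \<Omega>. weak_partial \<Omega> k w t
        = (weak_partial \<Omega> k (fst x) - weak_partial \<Omega> k (fst y)) t"
      unfolding w_def by (intro weak_partial_AE has_weak_partial_diff hwp assms(1))
    ultimately show ?thesis
      by eventually_elim (simp add: h_def r_def algebra_simps)
  qed
  have "L2n_inner \<Omega> r (nabla_w \<Omega> w) = 0"
  proof -
    have "L2n_inner \<Omega> r (nabla_w \<Omega> w)
        = L2n_inner \<Omega> (snd x) (nabla_w \<Omega> w) - L2n_inner \<Omega> (snd y) (nabla_w \<Omega> w)"
      by (simp add: L2n_inner_def r_def nabla_w_def L2_inner_diff_left wL2 L2q sum_subtractf)
    also have "\<dots> = L2_inner \<Omega> (nabla0_adj \<Omega> (snd x)) w - L2_inner \<Omega> (nabla0_adj \<Omega> (snd y)) w"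
      by (simp add: nabla0_adj_inner_W10[OF assms(1) gx w] nabla0_adj_inner_W10[OF assms(1) gy w])
    also have "\<dots> = 0"
      using hwp(3) L2_inner_cong_AE[OF L2q(3,4) _ _ adj_eq, of w w]
      by (simp add: has_weak_partial_def)
    finally show ?thesis .
  qed
  moreover have "L2n_inner \<Omega> r (nabla_w \<Omega> w)
      = (\<Sum>k\<in>UNIV. L2_inner \<Omega> (r $ k) (\<lambda>t. of_real (p t) * (r $ k) t)) + L2n_inner \<Omega> r h"
  proof -
    have "L2_inner \<Omega> (r $ k) (weak_partial \<Omega> k w)
        = L2_inner \<Omega> (r $ k) (\<lambda>t. of_real (p t) * (r $ k) t) + L2_inner \<Omega> (r $ k) (h $ k)" for k
      using L2_inner_cong_AE[OF r r wL2 L2_add[OF pr h] _ grad_eq, of k k]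
      by (simp add: L2_inner_add_right r pr h)
    then show ?thesis by (simp add: L2n_inner_def nabla_w_def sum.distrib)
  qed
  ultimately have "(\<Sum>k\<in>UNIV. L2_inner \<Omega> (r $ k) (\<lambda>t. of_real (p t) * (r $ k) t)) = - L2n_inner \<Omega> r h"
    by (simp add: eq_neg_iff_add_eq_0)
  then have pr_eq: "(\<Sum>k\<in>UNIV. Re (L2_inner \<Omega> (r $ k) (\<lambda>t. of_real (p t) * (r $ k) t))) = - Re (L2n_inner \<Omega> r h)"
    by (metis Re_sum uminus_complex.simps(1))
  have "\<epsilon> * (L2n_norm \<Omega> r)\<^sup>2 \<le> (\<Sum>k\<in>UNIV. Re (L2_inner \<Omega> (r $ k) (\<lambda>t. of_real (p t) * (r $ k) t)))"
    unfolding L2n_norm_sq sum_distrib_left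
    by (intro sum_mono L2_inner_mult_lower_bound[OF r p p_bounds(2,1)])
  also have "\<dots> \<le> cmod (L2n_inner \<Omega> r h)"
    unfolding pr_eq using abs_Re_le_cmod[of "L2n_inner \<Omega> r h"] by linarith
  also have "\<dots> \<le> L2n_norm \<Omega> r * L2n_norm \<Omega> h"
    using r h by (intro L2n_Cauchy_Schwarz) (auto simp: L2n_def)
  finally have r_le: "L2n_norm \<Omega> r \<le> L2n_norm \<Omega> h / \<epsilon>"
    using \<open>0 < \<epsilon>\<close> L2n_norm_nonneg[of \<Omega> r] L2n_norm_nonneg[of \<Omega> h]
    by (cases "L2n_norm \<Omega> r = 0") (simp_all add: power2_eq_square field_simps)
  have "L2n_norm \<Omega> (nabla_w \<Omega> w) \<le> M * L2n_norm \<Omega> r + L2n_norm \<Omega> h"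
  proof (rule L2n_norm_triangle_componentwise[OF _ \<open>0 \<le> M\<close>])
    fix k
    have "L2_norm \<Omega> (nabla_w \<Omega> w $ k) = L2_norm \<Omega> (\<lambda>t. of_real (p t) * (r $ k) t + (h $ k) t)"
      using grad_eq wL2 L2_add[OF pr h]
      by (intro L2_norm_cong_AE) (auto simp: nabla_w_def dest: L2_measurable)
    also have "\<dots> \<le> L2_norm \<Omega> (\<lambda>t. of_real (p t) * (r $ k) t) + L2_norm \<Omega> (h $ k)"
      by (intro L2_norm_triangle pr h)
    also have "\<dots> \<le> M * L2_norm \<Omega> (r $ k) + L2_norm \<Omega> (h $ k)"
      using L2_norm_bounded_mult[OF r p p_bounds(2) \<open>0 \<le> M\<close>] by simp
    finally show "L2_norm \<Omega> (nabla_w \<Omega> w $ k) \<le> M * L2_norm \<Omega> (r $ k) + L2_norm \<Omega> (h $ k)" .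
  qed
  also have "\<dots> \<le> M * (L2n_norm \<Omega> h / \<epsilon>) + L2n_norm \<Omega> h"
    using mult_left_mono[OF r_le \<open>0 \<le> M\<close>] by simp
  also have "\<dots> = (M / \<epsilon> + 1) * L2n_norm \<Omega> h"
    by (simp add: algebra_simps)
  finally have "L2n_norm \<Omega> (nabla_w \<Omega> w) \<le> (M / \<epsilon> + 1) * L2n_norm \<Omega> h" .
  moreover have "c * L2_norm \<Omega> w \<le> L2n_norm \<Omega> (nabla_w \<Omega> w)"
    using assms(2) w L2_norm_component_le[of \<Omega> "nabla_w \<Omega> w" j]
    by (auto simp: poincare_def nabla_w_def intro: order_trans)
  ultimately have w_le: "L2_norm \<Omega> w \<le> (M / \<epsilon> + 1) / c * L2n_norm \<Omega> h"
    using \<open>0 < c\<close> by (simp add: field_simps)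
  have "H_norm \<Omega> (x - y) \<le> L2_norm \<Omega> w + L2n_norm \<Omega> r"
    unfolding H_norm_def w_def r_def fst_diff snd_diff
    by (intro sqrt_sum_squares_le_sum L2_norm_nonneg L2n_norm_nonneg)
  also have "\<dots> \<le> ((M / \<epsilon> + 1) / c + 1 / \<epsilon>) * L2n_norm \<Omega> h"
    using w_le r_le by (simp add: distrib_right)
  finally show ?thesis by (simp add: h_def)
qed

lemma L2n_norm_mult_tendsto_0:
  fixes \<Omega> :: "(real^'n::finite) set"
  assumes q: "q \<in> L2n \<Omega>"
    and s: "\<And>\<nu>. s \<nu> \<in> borel_measurable (lebesgue_on \<Omega>)"
    and bound: "\<And>\<nu>. AE x in lebesgue_on \<Omega>. \<bar>s \<nu> x\<bar> \<le> M"
    and lim: "AE x in lebesgue_on \<Omega>. (\<lambda>\<nu>. s \<nu> x) \<longlonglongrightarrow> 0"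
  shows "(\<lambda>\<nu>::nat. L2n_norm \<Omega> (\<chi> k. (\<lambda>x. of_real (s \<nu> x) * (q $ k) x))) \<longlonglongrightarrow> 0"
proof -
  have "(\<lambda>\<nu>. (L2_norm \<Omega> (\<lambda>x. of_real (s \<nu> x) * (q $ k) x))\<^sup>2) \<longlonglongrightarrow> 0" for k
  proof -
    have qk: "q $ k \<in> L2 \<Omega>" using q by (simp add: L2n_def)
    have "(\<lambda>\<nu>. LINT x|lebesgue_on \<Omega>. (cmod (of_real (s \<nu> x) * (q $ k) x))\<^sup>2) \<longlonglongrightarrow> (LINT x|lebesgue_on \<Omega>. 0)"
    proof (rule integral_dominated_convergence)
      show "(\<lambda>x. (cmod (of_real (s \<nu> x) * (q $ k) x))\<^sup>2) \<in> borel_measurable (lebesgue_on \<Omega>)" for \<nu>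
        using s[of \<nu>] L2_measurable[OF qk] by measurable
      show "integrable (lebesgue_on \<Omega>) (\<lambda>x. M\<^sup>2 * (cmod ((q $ k) x))\<^sup>2)"
        using L2_sq_integrable[OF qk] by simp
      show "AE x in lebesgue_on \<Omega>. (\<lambda>\<nu>. (cmod (of_real (s \<nu> x) * (q $ k) x))\<^sup>2) \<longlonglongrightarrow> 0"
        using lim
      proof eventually_elim
        case (elim x)
        have "(\<lambda>\<nu>. (cmod (of_real (s \<nu> x) * (q $ k) x))\<^sup>2) \<longlonglongrightarrow> (cmod (of_real 0 * (q $ k) x))\<^sup>2"
          by (intro tendsto_intros elim)
        then show ?case by simp
      qed
      show "AE x in lebesgue_on \<Omega>. norm ((cmod (of_real (s \<nu> x) * (q $ k) x))\<^sup>2) \<le> M\<^sup>2 * (cmod ((q $ k) x))\<^sup>2" for \<nu>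
        using bound[of \<nu>]
        by eventually_elim (auto simp: norm_mult power_mult_distrib abs_le_square_iff[symmetric]
            intro!: mult_right_mono)
    qed simp
    then show ?thesis by (simp add: L2_norm_sq)
  qed
  then have "(\<lambda>\<nu>. sqrt (\<Sum>k\<in>UNIV. (L2_norm \<Omega> (\<lambda>x. of_real (s \<nu> x) * (q $ k) x))\<^sup>2))
      \<longlonglongrightarrow> sqrt (\<Sum>k\<in>(UNIV::'n set). 0)"
    by (intro tendsto_intros)
  then show ?thesis by (simp add: L2n_norm_def)
qed

lemma uniform_bound_from_Linf_norm:
  assumes "(SUP \<nu>. Linf_norm \<Omega> (p \<nu>)) < \<infinity>"
  obtains M where "0 \<le> M" "\<And>\<nu>. AE x in lebesgue_on \<Omega>. \<bar>p \<nu> x\<bar> \<le> M"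
proof -
  obtain n :: nat where n: "(SUP \<nu>. Linf_norm \<Omega> (p \<nu>)) < ereal (real n)"
    using assms less_PInf_Ex_of_nat[of "SUP \<nu>. Linf_norm \<Omega> (p \<nu>)"] by auto
  have "AE x in lebesgue_on \<Omega>. \<bar>p \<nu> x\<bar> \<le> real n" for \<nu>
  proof -
    have "Linf_norm \<Omega> (p \<nu>) \<le> ereal (real n)"
      using n SUP_upper[of \<nu> UNIV "\<lambda>\<nu>. Linf_norm \<Omega> (p \<nu>)"] by (simp add: order.strict_implies_order order_trans)
    moreover have "AE x in lebesgue_on \<Omega>. ereal \<bar>p \<nu> x\<bar> \<le> Linf_norm \<Omega> (p \<nu>)"
      unfolding Linf_norm_def by (rule esssup_AE)
    ultimately show ?thesis
      by (auto elim!: eventually_mono dest: order_trans)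
  qed
  then show thesis by (intro that[of "real n"]) auto
qed

theorem theorem5p0p7:
  fixes \<Omega> :: "(real^'n::finite) set"
    and p :: "nat \<Rightarrow> real^'n \<Rightarrow> real"
    and p_inf :: "real^'n \<Rightarrow> real"
  assumes "open \<Omega>" and "\<Omega> \<noteq> {}"
    and "\<exists>j c. c > 0 \<and> (\<forall>f\<in>W10 \<Omega>. L2_norm \<Omega> (weak_partial \<Omega> j f) \<ge> c * L2_norm \<Omega> f)"
    and "\<And>\<nu>. p \<nu> \<in> L_class \<Omega>"
    and "(SUP \<nu>. Linf_norm \<Omega> (p \<nu>)) < \<infinity>"
    and "\<exists>\<epsilon>>0. \<forall>\<nu>. AE x in lebesgue_on \<Omega>. p \<nu> x \<ge> \<epsilon>"
    and "p_inf \<in> L_class \<Omega>"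
    and "AE x in lebesgue_on \<Omega>. (\<lambda>\<nu>. p \<nu> x) \<longlonglongrightarrow> p_inf x"
  shows "\<forall>\<xi>\<in>H_space \<Omega>.
           (\<lambda>\<nu>. H_norm \<Omega> (A_hat_inv \<Omega> (p \<nu>) \<xi> - A_hat_inv \<Omega> p_inf \<xi>)) \<longlonglongrightarrow> 0"
proof
  fix \<xi> assume \<xi>: "\<xi> \<in> H_space \<Omega>"
  obtain j c where poin: "poincare \<Omega> j c"
    using assms(3) by (auto simp: poincare_def)
  obtain M0 where M0: "0 \<le> M0" "\<And>\<nu>. AE x in lebesgue_on \<Omega>. \<bar>p \<nu> x\<bar> \<le> M0"
    using uniform_bound_from_Linf_norm[OF assms(5)] by metis
  obtain \<epsilon> where \<epsilon>: "0 < \<epsilon>" "\<And>\<nu>. AE x in lebesgue_on \<Omega>. \<epsilon> \<le> p \<nu> x"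
    using assms(6) by auto
  have p: "p \<nu> \<in> borel_measurable (lebesgue_on \<Omega>)" for \<nu>
    using assms(4)[of \<nu>] by (simp add: L_class_def Linf_def)
  obtain a b where ab: "0 < a" "a \<le> b" and p_inf: "p_inf \<in> borel_measurable (lebesgue_on \<Omega>)"
    and p_inf_bounds: "AE x in lebesgue_on \<Omega>. a \<le> p_inf x \<and> p_inf x \<le> b"
    by (rule L_classD[OF assms(7)]) (rule that)
  define M where "M = max M0 b"
  have M: "0 \<le> M" and p_M: "AE x in lebesgue_on \<Omega>. \<bar>p \<nu> x\<bar> \<le> M" for \<nu>
    using M0(1) M0(2)[of \<nu>] by (auto simp: M_def elim: eventually_mono)
  have p_inf_M: "AE x in lebesgue_on \<Omega>. \<bar>p_inf x\<bar> \<le> M"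
    using p_inf_bounds by eventually_elim (use ab in \<open>auto simp: M_def\<close>)
  let ?y = "A_hat_inv \<Omega> p_inf \<xi>"
  let ?h = "\<lambda>\<nu>. L2n_norm \<Omega> (\<chi> k. (\<lambda>t. of_real (p \<nu> t - p_inf t) * (snd ?y $ k) t))"
  note inv = A_hat_inv_solves[OF assms(1) poin _ \<xi>]
  have "snd ?y \<in> L2n \<Omega>"
    using inv(1)[OF assms(7)] by (auto simp: A_hat_dom_def nabla0_adj_dom_def nabla0_adj_graph_iff)
  then have "?h \<longlonglongrightarrow> 0"
  proof (rule L2n_norm_mult_tendsto_0)
    show "(\<lambda>t. p \<nu> t - p_inf t) \<in> borel_measurable (lebesgue_on \<Omega>)" for \<nu>
      using p p_inf by measurable
    show "AE t in lebesgue_on \<Omega>. \<bar>p \<nu> t - p_inf t\<bar> \<le> 2 * M" for \<nu>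
      using p_M[of \<nu>] p_inf_M by eventually_elim linarith
    show "AE t in lebesgue_on \<Omega>. (\<lambda>\<nu>. p \<nu> t - p_inf t) \<longlonglongrightarrow> 0"
      using assms(8) by eventually_elim (simp add: LIM_zero)
  qed
  then have "(\<lambda>\<nu>. ((M / \<epsilon> + 1) / c + 1 / \<epsilon>) * ?h \<nu>) \<longlonglongrightarrow> 0"
    by (rule tendsto_mult_right_zero)
  then show "(\<lambda>\<nu>. H_norm \<Omega> (A_hat_inv \<Omega> (p \<nu>) \<xi> - ?y)) \<longlonglongrightarrow> 0"
  proof (rule Lim_null_comparison[rotated], intro always_eventually allI)
    fix \<nu>
    have "H_norm \<Omega> (A_hat_inv \<Omega> (p \<nu>) \<xi> - ?y) \<le> ((M / \<epsilon> + 1) / c + 1 / \<epsilon>) * ?h \<nu>"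
      by (rule A_hat_stability[OF assms(1) poin p \<epsilon>(1) M \<epsilon>(2) p_M p_inf p_inf_M
            inv[OF assms(4)] inv[OF assms(7)]])
    then show "norm (H_norm \<Omega> (A_hat_inv \<Omega> (p \<nu>) \<xi> - ?y)) \<le> ((M / \<epsilon> + 1) / c + 1 / \<epsilon>) * ?h \<nu>"
      by (simp add: H_norm_def)
  qed
qed

end
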